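(* For any integers $n\ge 1$ and $m\ge 1$, the following three quantities are equal: (1) the number of self-dual Fishburn matrices of reduced size $n$ whose last column has sum $m$ and whose diagonal cells are all equal to zero; (2) the number of self-dual Fishburn matrices of reduced size $n$ whose last column has sum $m$ and whose diagonal cells are not all equal to zero; (3) the number of row-Fishburn matrices of size $n$ whose last column has sum $m$. Moreover, for integers $n,m,p,q$ with $p+q\ge 1$, the number of self-dual Fishburn matrices $M$ with $\mathrm{rs}(M)=n$, $\max(M)=m$, $\mathrm{dg}(M)=p$ and $\mathrm{iso}(M)=q$ is equal to the number of row-Fishburn matrices $N$ of size $n$ with $\max(N)=m$, $\min(N)=p$ and $\mathrm{iso}(N)=q$. All these equalities remain valid when all matrices involved are restricted to be primitive (entries in $\{0,1\}$).
   Context: A Fishburn matrix is an upper-triangular square matrix of nonnegative integers in which every row and every column contains a nonzero entry. A row-Fishburn matrix is an upper-triangular square matrix of nonnegative integers in which every row contains a nonzero entry. A matrix is primitive if all its entries are $0$ or $1$. The size of a matrix is the sum of its entries. Rows and columns of a $k\times k$ matrix are numbered $1,\dots,k$; the corner cell is $(1,k)$. A $k\times k$ matrix $M$ is self-dual if $M_{ij}=M_{k+1-j,k+1-i}$ for all $i,j$. A cell $(i,j)$ is a diagonal cell if $i+j=k+1$ and an SE-cell if $i+j>k+1$. Statistics: $\mathrm{iso}$ = value of the corner cell; $\min$ = sum of the first row excluding the corner cell; $\max$ = sum of the last column excluding the corner cell; $\mathrm{dg}$ = sum of the diagonal cells excluding the corner cell. The reduced size $\mathrm{rs}(M)$ of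 a self-dual Fishburn matrix is the sum of all its diagonal cells and SE-cells. *)

theory Defs
  imports "Jordan_Normal_Form.Matrix"
begin

text \<open>Matrices are indexed from 0: the cell in row \<open>i\<close> and column \<open>j\<close> of a
  \<open>k\<times>k\<close> matrix, with \<open>i, j \<in> {1..k}\<close>, is the entry at \<open>(i - 1, j - 1)\<close>.  So the corner is
  \<open>(0, k - 1)\<close>, the diagonal condition \<open>i + j = k + 1\<close> becomes \<open>i + j + 1 = k\<close> and the
  SE-condition \<open>i + j > k + 1\<close> becomes \<open>i + j + 1 > k\<close>.
  The corner cell exists only for \<open>k > 0\<close>, so the empty matrix is excluded.\<close>

definition row_fishburn :: "nat mat \<Rightarrow> bool" where
  "row_fishburn M \<longleftrightarrow> square_mat M \<and> dim_row M > 0 \<and> upper_triangular M \<and>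
     (\<forall>i < dim_row M. \<exists>j < dim_col M. M $$ (i, j) \<noteq> 0)"

definition fishburn :: "nat mat \<Rightarrow> bool" where
  "fishburn M \<longleftrightarrow> square_mat M \<and> dim_row M > 0 \<and> upper_triangular M \<and>
     (\<forall>i < dim_row M. \<exists>j < dim_col M. M $$ (i, j) \<noteq> 0) \<and>
     (\<forall>j < dim_col M. \<exists>i < dim_row M. M $$ (i, j) \<noteq> 0)"

definition primitive_mat :: "nat mat \<Rightarrow> bool" where
  "primitive_mat M \<longleftrightarrow> (\<forall>i < dim_row M. \<forall>j < dim_col M. M $$ (i, j) \<in> {0, 1})"

definition self_dual :: "nat mat \<Rightarrow> bool" where
  "self_dual M \<longleftrightarrow> square_mat M \<and>
     (\<forall>i < dim_row M. \<forall>j < dim_row M.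
        M $$ (i, j) = M $$ (dim_row M - 1 - j, dim_row M - 1 - i))"

definition mat_size :: "nat mat \<Rightarrow> nat" where
  "mat_size M = (\<Sum>i < dim_row M. \<Sum>j < dim_col M. M $$ (i, j))"

definition diagonal_cells :: "nat mat \<Rightarrow> (nat \<times> nat) set" where
  "diagonal_cells M = {(i, j). i < dim_row M \<and> j < dim_row M \<and> i + j + 1 = dim_row M}"

definition SE_cells :: "nat mat \<Rightarrow> (nat \<times> nat) set" where
  "SE_cells M = {(i, j). i < dim_row M \<and> j < dim_row M \<and> i + j + 1 > dim_row M}"

definition corner_cell :: "nat mat \<Rightarrow> nat \<times> nat" where
  "corner_cell M = (0, dim_row M - 1)"

definition iso_stat :: "nat mat \<Rightarrow> nat" where
  "iso_stat M = M $$ corner_cell M"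

definition min_stat :: "nat mat \<Rightarrow> nat" where
  "min_stat M = (\<Sum>j \<in> {..<dim_row M} - {dim_row M - 1}. M $$ (0, j))"

definition max_stat :: "nat mat \<Rightarrow> nat" where
  "max_stat M = (\<Sum>i \<in> {..<dim_row M} - {0}. M $$ (i, dim_row M - 1))"

definition dg_stat :: "nat mat \<Rightarrow> nat" where
  "dg_stat M = (\<Sum>c \<in> diagonal_cells M - {corner_cell M}. M $$ c)"

definition last_col_sum :: "nat mat \<Rightarrow> nat" where
  "last_col_sum M = (\<Sum>i < dim_row M. M $$ (i, dim_row M - 1))"

definition reduced_size :: "nat mat \<Rightarrow> nat" where
  "reduced_size M = (\<Sum>c \<in> diagonal_cells M \<union> SE_cells M. M $$ c)"

definition diagonal_zero :: "nat mat \<Rightarrow> bool" where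
  "diagonal_zero M \<longleftrightarrow> (\<forall>c \<in> diagonal_cells M. M $$ c = 0)"

end

theory Submission
  imports Defs "HOL-Computational_Algebra.Polynomial"
begin

text \<open>
  Reflecting the columns turns a self-dual matrix of dimension \<open>k\<close> into a weighted graph with loops
  on \<open>{0, \<dots>, k - 1}\<close> whose edges \<open>{l, i}\<close> satisfy \<open>l + i < k\<close>: the last column becomes the star of
  the vertex \<open>0\<close>, the diagonal cells become the loops, and the matrix is Fishburn iff no vertex is
  isolated.  Let \<open>b\<close>, \<open>Y\<close>, \<open>\<zeta>\<close>, \<open>\<omega>\<close> be the generating functions of a generic cell, a cell of the
  last column, a diagonal cell and the corner.  Inclusion-exclusion over the isolated
  vertices gives \<open>\<omega> E\<^sub>d(Y)\<close> for the matrices of dimension \<open>d + 1\<close> (minus \<open>1\<close> if \<open>d = 0\<close>), where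
  \<open>E\<^sub>0 = 1\<close>, \<open>E\<^sub>1 = Y - 1\<close> and \<open>E\<^sub>d\<^sub>+\<^sub>2(Y) = (Y - 1) (\<zeta> Y E\<^sub>d(b Y) - E\<^sub>d(Y))\<close>.
  Summing over \<open>d\<close>, the series \<open>\<Phi> = \<Sum>\<^sub>d E\<^sub>d\<close> satisfies \<open>Y \<Phi>(Y) = Y + (Y - 1) \<zeta> Y \<Phi>(b Y)\<close>, so that
  \<open>\<Phi>(Y) = 1 + \<zeta> (Y - 1) \<Phi>(b Y) = \<Sum>\<^sub>k \<zeta>\<^sup>k (Y - 1) (b Y - 1) \<dots> (b\<^sup>k\<^sup>-\<^sup>1 Y - 1)\<close>.
  The rows of a row-Fishburn matrix are independent, so these matrices have the generating function
  \<open>\<Sum>\<^sub>k (\<omega> \<zeta>\<^sup>k - 1) (Y - 1) (b Y - 1) \<dots> (b\<^sup>k\<^sup>-\<^sup>1 Y - 1) = \<omega> \<Phi>\<^sub>\<zeta>(Y) - \<Phi>\<^sub>1(Y)\<close>, and \<open>\<zeta> = \<omega> = 1\<close> selects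
  the matrices with zero diagonal.

  The series \<open>\<Phi>\<close> converges only formally, so the identities are stated as congruences modulo \<open>x\<^sup>R\<close>
  in an arbitrary commutative ring.  Bounding the entries by \<open>K\<close> makes all generating functions
  polynomials; \<open>K = 1\<close> is the primitive case, and \<open>K = n\<close> is no restriction for size \<open>n\<close>.
\<close>

section \<open>The functional equation\<close>

text \<open>\<open>b\<close> is the weight of a generic edge, \<open>z\<close> of a loop and
  \<open>Y\<close> of an edge to the vertex 0. The combinatorial meaning is given by
  \<open>cover_poly_conv_sum\<close>; taking the recursion as definition makes the functional
  equation immediate.\<close>

fun cover_poly :: "'a \<Rightarrow> 'a \<Rightarrow> nat \<Rightarrow> 'a \<Rightarrow> 'a::comm_ring_1" where
  "cover_poly b z 0 Y = 1"
| "cover_poly b z (Suc 0) Y = Y - 1"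
| "cover_poly b z (Suc (Suc k)) Y =
     (Y - 1) * (z * Y * cover_poly b z k (b * Y) - cover_poly b z k Y)"

text \<open>The factor with index \<open>i\<close> counts the nonzero rows with \<open>i\<close>
  generic cells and one cell in the last column.\<close>

definition row_poly :: "'a \<Rightarrow> nat \<Rightarrow> 'a \<Rightarrow> 'a::comm_ring_1" where
  "row_poly b k Y = (\<Prod>i<k. b ^ i * Y - 1)"

lemma row_poly_0 [simp]: "row_poly b 0 Y = 1"
  by (simp add: row_poly_def)

lemma row_poly_Suc: "row_poly b (Suc k) Y = (Y - 1) * row_poly b k (b * Y)"
  unfolding row_poly_def prod.lessThan_Suc_shift by (simp add: mult_ac)

lemma dvd_mult_minus_one:
  fixes x a b :: "'a::comm_ring_1"
  assumes "x dvd a - 1" "x dvd b - 1"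
  shows "x dvd a * b - 1"
proof -
  have "a * b - 1 = (a - 1) * b + (b - 1)" by (simp add: algebra_simps)
  with assms show ?thesis by (metis dvd_add dvd_mult2)
qed

text \<open>Formal convergence: two steps of the index gain one factor \<open>Y - 1\<close>, hence
  one factor \<open>x\<close>, and \<open>b * Y\<close> is again congruent to 1 modulo
  \<open>x\<close>, so the induction hypothesis covers both terms.\<close>

lemma power_dvd_cover_poly:
  fixes x Y b z :: "'a::comm_ring_1"
  assumes "x dvd b - 1" "x dvd Y - 1"
  shows "x ^ (Suc k div 2) dvd cover_poly b z k Y"
  using assms
proof (induction b z k Y rule: cover_poly.induct)
  case (3 b z k Y)
  have "x ^ (Suc k div 2) dvd z * Y * cover_poly b z k (b * Y) - cover_poly b z k Y"
    using "3.IH" "3.prems" dvd_mult_minus_one[of x b Y] by (intro dvd_diff dvd_mult) auto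
  with \<open>x dvd Y - 1\<close> have "x * x ^ (Suc k div 2) dvd cover_poly b z (Suc (Suc k)) Y"
    by (simp only: cover_poly.simps mult_dvd_mono)
  thus ?case by simp
qed simp_all

lemma power_dvd_row_poly:
  fixes x Y b :: "'a::comm_ring_1"
  assumes "x dvd b - 1" "x dvd Y - 1"
  shows "x ^ k dvd row_poly b k Y"
  using assms(2)
proof (induction k arbitrary: Y)
  case (Suc k)
  thus ?case using dvd_mult_minus_one[OF assms(1) Suc.prems]
    by (simp add: row_poly_Suc mult_dvd_mono)
qed simp

text \<open>\<open>Y\<close> need not be invertible. If \<open>x ^ j\<close> divides
  \<open>g\<close>, then \<open>x ^ Suc j\<close> divides \<open>(Y - 1) * g\<close>, and
  \<open>g = Y * g - (Y - 1) * g\<close> gains one power at a time, up to \<open>n\<close>.\<close>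

lemma power_dvd_cancel_unipotent:
  fixes x Y g :: "'a::comm_ring_1"
  assumes "x dvd Y - 1" "x ^ n dvd Y * g"
  shows "x ^ n dvd g"
proof -
  have "x ^ j dvd g" if "j \<le> n" for j
    using that
  proof (induction j)
    case (Suc j)
    have "x ^ Suc j dvd Y * g" using Suc.prems assms(2) le_imp_power_dvd dvd_trans by blast
    moreover have "x ^ Suc j dvd (Y - 1) * g"
      using Suc assms(1) by (simp add: mult_dvd_mono)
    ultimately have "x ^ Suc j dvd Y * g - (Y - 1) * g" by (rule dvd_diff)
    thus ?case by (simp add: algebra_simps)
  qed simp
  thus ?thesis by simp
qed

text \<open>The first two terms add up to \<open>1 + (Y - 1) = Y\<close>. Truncation at an even
  index lets the recursion, which moves by two, pass from \<open>Suc R\<close> to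
  \<open>R\<close>.\<close>

lemma sum_cover_poly_rec:
  "(\<Sum>k<2 * Suc R. cover_poly b z k Y) =
    Y + (Y - 1) * (z * Y * (\<Sum>k<2 * R. cover_poly b z k (b * Y)) - (\<Sum>k<2 * R. cover_poly b z k Y))"
proof -
  have "2 * Suc R = Suc (Suc (2 * R))" by simp
  thus ?thesis
    by (simp only: sum.lessThan_Suc_shift cover_poly.simps)
      (simp add: sum_distrib_left sum_subtractf right_diff_distrib)
qed

text \<open>Both sums satisfy truncated forms of the same functional equation. It relates
  \<open>Y\<close> to \<open>b * Y\<close>, so \<open>Y\<close> stays arbitrary in the induction;
  each level gains a power of \<open>x\<close> from the factor \<open>Y - 1\<close>.\<close>

lemma cover_poly_sum_cong:
  fixes x Y b z :: "'a::comm_ring_1"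
  assumes "x dvd b - 1" "x dvd Y - 1"
  shows "x ^ R dvd (\<Sum>k<2 * R. cover_poly b z k Y) - (\<Sum>k<R. z ^ k * row_poly b k Y)"
  using assms(2)
proof (induction R arbitrary: Y)
  case (Suc R)
  define F where "F = (\<lambda>R Y. \<Sum>k<2 * R. cover_poly b z k Y)"
  define P where "P = (\<lambda>R Y. \<Sum>k<R. z ^ k * row_poly b k Y)"
  have F: "F (Suc R) Y = Y + (Y - 1) * (z * Y * F R (b * Y) - F R Y)"
    unfolding F_def by (rule sum_cover_poly_rec)
  have P: "P (Suc R) Y = 1 + z * (Y - 1) * P R (b * Y)"
    unfolding P_def
    by (simp only: sum.lessThan_Suc_shift row_poly_Suc row_poly_0)
      (simp add: sum_distrib_left mult_ac)
  \<comment> \<open>The recursion \<open>F\<close> has \<open>F R Y\<close> on its right-hand side.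
    Replacing it by \<open>F (Suc R) Y\<close> costs only the two new terms, multiples of
    \<open>x ^ R\<close>, and produces the factor \<open>Y\<close> on the left of the functional
    equation.\<close>
  have "x ^ R dvd F (Suc R) Y - F R Y"
  proof -
    have "x ^ R dvd cover_poly b z (2 * R) Y" "x ^ Suc R dvd cover_poly b z (Suc (2 * R)) Y"
      using power_dvd_cover_poly[OF assms(1) Suc.prems, of "2 * R" z]
        power_dvd_cover_poly[OF assms(1) Suc.prems, of "Suc (2 * R)" z] by simp_all
    moreover have "F (Suc R) Y - F R Y = cover_poly b z (2 * R) Y + cover_poly b z (Suc (2 * R)) Y"
      by (simp add: F_def)
    ultimately show ?thesis by (metis dvd_add power_Suc2 dvd_mult_left)
  qed
  moreover have "x ^ R dvd F R (b * Y) - P R (b * Y)"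
    using Suc.IH[OF dvd_mult_minus_one[OF assms(1) Suc.prems]] by (simp add: F_def P_def)
  ultimately have
    "x * x ^ R dvd (Y - 1) * ((F (Suc R) Y - F R Y) + z * Y * (F R (b * Y) - P R (b * Y)))"
    using Suc.prems by (intro mult_dvd_mono dvd_add dvd_mult)
  also have "\<dots> = Y * (F (Suc R) Y - P (Suc R) Y)"
    unfolding P F by (simp add: algebra_simps)
  finally have "x ^ Suc R dvd Y * (F (Suc R) Y - P (Suc R) Y)"
    unfolding power_Suc .
  hence "x ^ Suc R dvd F (Suc R) Y - P (Suc R) Y"
    by (rule power_dvd_cancel_unipotent[OF Suc.prems])
  thus ?case unfolding F_def P_def .
qed simp

section \<open>Inclusion-exclusion over uncovered vertices\<close>

text \<open>The exponent is a sum of the same parity as \<open>card V - card A\<close>, which avoids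
  truncated subtraction.\<close>

lemma prod_diff_expand:
  fixes g h :: "'v \<Rightarrow> 'a::comm_ring_1"
  assumes "finite V"
  shows "(\<Prod>v\<in>V. g v - h v) =
    (\<Sum>A\<in>Pow V. (-1) ^ (card V + card A) * (\<Prod>v\<in>A. g v) * (\<Prod>v\<in>V - A. h v))"
  unfolding prod_diff_conv_sum'[OF assms]
proof (rule sum.cong[OF refl])
  fix A assume "A \<in> Pow V"
  hence "card A \<le> card V" using assms by (simp add: card_mono)
  hence "card V + card A = (card V - card A) + 2 * card A" by simp
  hence "(-1::'a) ^ (card V - card A) = (-1) ^ (card V + card A)"
    by (simp only: power_add power_mult) simp
  thus "(-1) ^ (card V - card A) * (\<Prod>v\<in>A. g v) * (\<Prod>v\<in>V - A. h v) =
      (-1) ^ (card V + card A) * (\<Prod>v\<in>A. g v) * (\<Prod>v\<in>V - A. h v)" by (simp only:)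
qed

text \<open>Inclusion-exclusion, with \<open>V - A\<close> the set of vertices prescribed as
  uncovered: exactly the edges inside \<open>A\<close> remain free, and the sum over all fillings
  factors edge by edge. Arbitrary sets of ends serve both for graphs and for rows.\<close>

lemma sum_covering_weights:
  fixes w :: "'e \<Rightarrow> 'a::comm_ring_1" and ends :: "'e \<Rightarrow> 'v set"
  assumes "finite E" "finite V" and ends: "\<And>e. e \<in> E \<Longrightarrow> ends e \<subseteq> V"
  shows "(\<Sum>f | f \<in> E \<rightarrow>\<^sub>E {..K} \<and> (\<forall>v\<in>V. \<exists>e\<in>E. v \<in> ends e \<and> f e \<noteq> 0). \<Prod>e\<in>E. w e ^ f e) =
    (\<Sum>A\<in>Pow V. (-1) ^ (card V + card A) * (\<Prod>e | e \<in> E \<and> ends e \<subseteq> A. \<Sum>a\<le>K. w e ^ a))"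
proof -
  define iso where "iso = (\<lambda>f v. if \<forall>e\<in>E. v \<in> ends e \<longrightarrow> f e = (0::nat) then 1 else (0::'a))"
  have fin: "finite (E \<rightarrow>\<^sub>E {..K})" using assms(1) by (simp add: finite_PiE)
  have ind: "(if \<forall>v\<in>V. \<exists>e\<in>E. v \<in> ends e \<and> f e \<noteq> 0 then 1 else 0) = (\<Prod>v\<in>V. 1 - iso f v)" for f
  proof (cases "\<forall>v\<in>V. \<exists>e\<in>E. v \<in> ends e \<and> f e \<noteq> 0")
    case True
    hence "(\<Prod>v\<in>V. 1 - iso f v) = (\<Prod>v\<in>V. 1)" by (intro prod.cong) (auto simp: iso_def)
    with True show ?thesis by simp
  next
    case False
    then obtain v where "v \<in> V" "iso f v = 1" by (auto simp: iso_def)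
    hence "(\<Prod>v\<in>V. 1 - iso f v) = 0" using assms(2) by (intro prod_zero) auto
    with False show ?thesis by simp
  qed
  \<comment> \<open>By \<open>ends\<close>, an edge not inside \<open>A\<close> meets
    \<open>V - A\<close>. So the product of indicators is nonzero exactly when all such edges carry
    0, and then they contribute the factor 1.\<close>
  have iso_prod: "(\<Prod>v\<in>V - A. iso f v) * (\<Prod>e\<in>E. w e ^ f e) =
      (\<Prod>e\<in>E. if ends e \<subseteq> A then w e ^ f e else if f e = 0 then 1 else 0)"
    if "A \<subseteq> V" for A f
  proof (cases "\<forall>e\<in>E. \<not> ends e \<subseteq> A \<longrightarrow> f e = 0")
    case True
    hence "(\<Prod>v\<in>V - A. iso f v) = (\<Prod>v\<in>V - A. 1)" by (intro prod.cong) (auto simp: iso_def)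
    moreover have "(\<Prod>e\<in>E. w e ^ f e) =
        (\<Prod>e\<in>E. if ends e \<subseteq> A then w e ^ f e else if f e = 0 then 1 else 0)"
      using True by (intro prod.cong) auto
    ultimately show ?thesis by simp
  next
    case False
    then obtain e where e: "e \<in> E" "\<not> ends e \<subseteq> A" "f e \<noteq> 0" by auto
    then obtain v where v: "v \<in> ends e" "v \<in> V - A" using ends by blast
    have "iso f v = 0" using e v by (auto simp: iso_def)
    hence "(\<Prod>v\<in>V - A. iso f v) = 0" using assms(2) v by (intro prod_zero) auto
    moreover have "(\<Prod>e\<in>E. if ends e \<subseteq> A then w e ^ f e else if f e = 0 then 1 else 0) = 0"
      using e assms(1) by (intro prod_zero) auto
    ultimately show ?thesis by simp
  qed
  have "(\<Sum>f | f \<in> E \<rightarrow>\<^sub>E {..K} \<and> (\<forall>v\<in>V. \<exists>e\<in>E. v \<in> ends e \<and> f e \<noteq> 0). \<Prod>e\<in>E. w e ^ f e) =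
    (\<Sum>f\<in>E \<rightarrow>\<^sub>E {..K}. if \<forall>v\<in>V. \<exists>e\<in>E. v \<in> ends e \<and> f e \<noteq> 0 then \<Prod>e\<in>E. w e ^ f e else 0)"
    using sum.inter_filter[OF fin] by simp
  also have "\<dots> = (\<Sum>f\<in>E \<rightarrow>\<^sub>E {..K}. (\<Prod>v\<in>V. 1 - iso f v) * (\<Prod>e\<in>E. w e ^ f e))"
    unfolding ind[symmetric] by (intro sum.cong) auto
  also have "\<dots> = (\<Sum>f\<in>E \<rightarrow>\<^sub>E {..K}. \<Sum>A\<in>Pow V. (-1) ^ (card V + card A) *
      ((\<Prod>v\<in>V - A. iso f v) * (\<Prod>e\<in>E. w e ^ f e)))"
  proof (intro sum.cong refl)
    fix f
    have "(\<Prod>v\<in>V. 1 - iso f v) = (\<Sum>A\<in>Pow V. (-1) ^ (card V + card A) * (\<Prod>v\<in>V - A. iso f v))"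
      unfolding prod_diff_expand[OF assms(2)] by simp
    thus "(\<Prod>v\<in>V. 1 - iso f v) * (\<Prod>e\<in>E. w e ^ f e) = (\<Sum>A\<in>Pow V. (-1) ^ (card V + card A) *
      ((\<Prod>v\<in>V - A. iso f v) * (\<Prod>e\<in>E. w e ^ f e)))"
      by (simp add: sum_distrib_right mult.assoc)
  qed
  also have "\<dots> = (\<Sum>A\<in>Pow V. (-1) ^ (card V + card A) *
      (\<Sum>f\<in>E \<rightarrow>\<^sub>E {..K}. \<Prod>e\<in>E. if ends e \<subseteq> A then w e ^ f e else if f e = 0 then 1 else 0))"
    by (subst sum.swap) (auto intro!: sum.cong simp: iso_prod sum_distrib_left)
  also have "\<dots> = (\<Sum>A\<in>Pow V. (-1) ^ (card V + card A) *
      (\<Prod>e\<in>E. \<Sum>a\<le>K. if ends e \<subseteq> A then w e ^ a else if a = 0 then 1 else 0))"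
    by (subst prod_sum_PiE) (auto simp: assms(1))
  also have "\<dots> = (\<Sum>A\<in>Pow V. (-1) ^ (card V + card A) *
      (\<Prod>e | e \<in> E \<and> ends e \<subseteq> A. \<Sum>a\<le>K. w e ^ a))"
    by (intro sum.cong refl arg_cong2[of _ _ _ _ "(*)"], subst prod.inter_filter[OF assms(1)])
      (auto intro!: prod.cong)
  finally show ?thesis .
qed

lemma sum_Pow_insert:
  fixes g :: "'v set \<Rightarrow> 'a::comm_monoid_add"
  assumes "finite V" "v \<notin> V"
  shows "(\<Sum>A\<in>Pow (insert v V). g A) = (\<Sum>A\<in>Pow V. g A) + (\<Sum>A\<in>Pow V. g (insert v A))"
proof -
  have "(\<Sum>A\<in>Pow (insert v V). g A) = (\<Sum>A\<in>Pow V. g A) + (\<Sum>A\<in>insert v ` Pow V. g A)"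
    unfolding Pow_insert by (rule sum.union_disjoint) (use assms in auto)
  also have "(\<Sum>A\<in>insert v ` Pow V. g A) = (\<Sum>A\<in>Pow V. g (insert v A))"
    by (subst sum.reindex) (use assms in \<open>auto intro!: inj_onI simp: o_def\<close>)
  finally show ?thesis .
qed

text \<open>The vertex \<open>l\<close> stands for row \<open>l\<close> and column \<open>k - l\<close>: the edge \<open>(l, i)\<close> is the cell
  \<open>(i, k - l)\<close> of a matrix of dimension \<open>k + 1\<close>.\<close>

definition edges_within :: "nat \<Rightarrow> nat set \<Rightarrow> (nat \<times> nat) set" where
  "edges_within k A = {(l, i). l \<in> A \<and> i \<in> A \<and> l \<le> i \<and> l + i \<le> k}"

lemma finite_edges_within [simp]: "finite (edges_within k A)"
  by (rule finite_subset[of _ "{..k} \<times> {..k}"]) (auto simp: edges_within_def)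

definition edge_weight :: "'a \<Rightarrow> 'a \<Rightarrow> nat \<times> nat \<Rightarrow> 'a" where
  "edge_weight b z = (\<lambda>(l, i). if l = i then z else b)"

text \<open>A vertex of \<open>A\<close> contributes a sign and the weight \<open>Y\<close> of its
  edge to 0. The recursion removes the two extreme vertices of \<open>{1..k + 2}\<close>: the
  largest is joined to no positive vertex, the smallest to itself and to all others but the
  largest.\<close>

lemma cover_poly_conv_sum:
  fixes b z Y :: "'a::comm_ring_1"
  shows "cover_poly b z k Y =
    (-1) ^ k * (\<Sum>A\<in>Pow {1..k}. (- Y) ^ card A * prod (edge_weight b z) (edges_within k A))"
proof (induction b z k Y rule: cover_poly.induct)
  case (1 b z Y)
  show ?case by (simp add: edges_within_def)
next
  case (2 b z Y)
  have "edges_within (Suc 0) {Suc 0} = {}" by (auto simp: edges_within_def)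
  moreover have "edges_within (Suc 0) {} = {}" by (auto simp: edges_within_def)
  moreover have "Pow {Suc 0} = {{}, {Suc 0}}" by auto
  ultimately show ?case by simp
next
  case (3 b z k Y)
  define g where "g = (\<lambda>Y k A. (- Y) ^ card A * prod (edge_weight b z) (edges_within k A))"
  let ?m = "Suc (Suc k)"
  have V: "{1..?m} = insert ?m (insert 1 {2..Suc k})" by auto
  have top: "g Y ?m (insert ?m A) = (- Y) * g Y ?m A" if "A \<subseteq> insert 1 {2..Suc k}" for A
  proof -
    have "edges_within ?m (insert ?m A) = edges_within ?m A"
      using that by (fastforce simp: edges_within_def)
    moreover have "finite A" "?m \<notin> A" using that finite_subset by (blast, auto)
    ultimately show ?thesis by (simp add: g_def)
  qed
  \<comment> \<open>The vertex 1 contributes its own \<open>- Y\<close>, its loop \<open>z\<close>,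
    and an edge of weight \<open>b\<close> to every vertex of \<open>A\<close>; these edges are
    absorbed by replacing \<open>Y\<close> with \<open>b * Y\<close>.\<close>
  have one: "g Y ?m (insert 1 A) = (- (z * Y)) * g (b * Y) ?m A" if "A \<subseteq> {2..Suc k}" for A
  proof -
    have fin: "finite A" and notin: "1 \<notin> A" using that finite_subset by (blast, auto)
    have "edges_within ?m (insert 1 A) = insert (1, 1) (({1} \<times> A) \<union> edges_within ?m A)"
      using that by (auto simp: edges_within_def)
    moreover have "prod (edge_weight b z) ({1} \<times> A) = b ^ card A"
    proof -
      have "prod (edge_weight b z) ({1} \<times> A) = (\<Prod>e\<in>{1::nat} \<times> A. b)"
        by (rule prod.cong) (use notin in \<open>auto simp: edge_weight_def\<close>)
      thus ?thesis by (simp add: card_cartesian_product)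
    qed
    moreover have "prod (edge_weight b z) (insert (1, 1) (({1} \<times> A) \<union> edges_within ?m A)) =
        z * (prod (edge_weight b z) ({1} \<times> A) * prod (edge_weight b z) (edges_within ?m A))"
      using notin fin
      by (subst prod.insert, simp, force simp: edges_within_def, subst prod.union_disjoint)
        (auto simp: edges_within_def edge_weight_def finite_edges_within[unfolded edges_within_def])
    moreover have "(- (b * Y)) ^ card A = b ^ card A * (- Y) ^ card A"
      by (simp flip: power_mult_distrib)
    ultimately show ?thesis using fin notin by (simp add: g_def mult_ac)
  qed
  \<comment> \<open>Lowering both labels by one turns the bound \<open>l + i \<le> k + 2\<close>
    into \<open>l + i \<le> k\<close> and preserves loops.\<close>
  have shift: "(\<Sum>A\<in>Pow {2..Suc k}. g Y ?m A) = (\<Sum>A\<in>Pow {1..k}. g Y k A)" for Y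
  proof (rule sum.reindex_cong[of "image Suc"])
    show "inj_on (image Suc) (Pow {1..k})" by (simp add: inj_on_image_Pow)
    have "{2..Suc k} = Suc ` {1..k}" by (simp add: numeral_2_eq_2)
    thus "Pow {2..Suc k} = image Suc ` Pow {1..k}" by (simp only: image_Pow_surj)
    fix A assume "A \<in> Pow {1..k}"
    have "edges_within ?m (Suc ` A) = map_prod Suc Suc ` edges_within k A"
      by (auto simp: edges_within_def image_iff)
    moreover have "inj_on (map_prod Suc Suc) (edges_within k A)" by (auto intro!: inj_onI)
    moreover have "edge_weight b z \<circ> map_prod Suc Suc = edge_weight b z"
      by (auto simp: edge_weight_def fun_eq_iff)
    ultimately show "g Y ?m (Suc ` A) = g Y k A"
      by (simp add: g_def card_image prod.reindex)
  qed
  have "(\<Sum>A\<in>Pow {1..?m}. g Y ?m A) =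
      (1 - Y) * (\<Sum>A\<in>Pow (insert 1 {2..Suc k}). g Y ?m A)"
    unfolding V by (subst sum_Pow_insert) (simp_all add: top sum_negf left_diff_distrib flip: sum_distrib_left)
  also have "(\<Sum>A\<in>Pow (insert 1 {2..Suc k}). g Y ?m A) =
      (\<Sum>A\<in>Pow {2..Suc k}. g Y ?m A) - z * Y * (\<Sum>A\<in>Pow {2..Suc k}. g (b * Y) ?m A)"
    by (subst sum_Pow_insert) (simp_all add: one[simplified] sum_distrib_left sum_negf)
  also have "\<dots> = (\<Sum>A\<in>Pow {1..k}. g Y k A) - z * Y * (\<Sum>A\<in>Pow {1..k}. g (b * Y) k A)"
    unfolding shift ..
  finally have *: "(\<Sum>A\<in>Pow {1..?m}. g Y ?m A) = (1 - Y) *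
      ((\<Sum>A\<in>Pow {1..k}. g Y k A) - z * Y * (\<Sum>A\<in>Pow {1..k}. g (b * Y) k A))" .
  have "(-1) ^ ?m * (\<Sum>A\<in>Pow {1..?m}. g Y ?m A) = (Y - 1) *
     (z * Y * ((-1) ^ k * (\<Sum>A\<in>Pow {1..k}. g (b * Y) k A)) - (-1) ^ k * (\<Sum>A\<in>Pow {1..k}. g Y k A))"
    unfolding * by (simp add: algebra_simps)
  thus ?case using 3 by (simp add: g_def)
qed

section \<open>Generating functions of matrices\<close>

lemma prod_class_weights:
  fixes x y z w :: "'a::comm_ring_1" and f :: "'e \<Rightarrow> nat"
  assumes "finite E"
  shows "(\<Prod>e\<in>E. (x * (if P e then y else 1) * (if Q e then z else 1) * (if R e then w else 1)) ^ f e) =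
    x ^ (\<Sum>e\<in>E. f e) * y ^ (\<Sum>e | e \<in> E \<and> P e. f e) * z ^ (\<Sum>e | e \<in> E \<and> Q e. f e) *
    w ^ (\<Sum>e | e \<in> E \<and> R e. f e)"
proof -
  have "(\<Prod>e\<in>E. (if P e then y else 1) ^ f e) = y ^ (\<Sum>e | e \<in> E \<and> P e. f e)" for P :: "'e \<Rightarrow> bool" and y :: 'a
    unfolding power_sum prod.inter_filter[OF assms] by (intro prod.cong) auto
  thus ?thesis by (simp add: power_mult_distrib prod.distrib power_sum)
qed

definition bounded_entries :: "nat \<Rightarrow> nat mat \<Rightarrow> bool" where
  "bounded_entries K M \<longleftrightarrow> (\<forall>i < dim_row M. \<forall>j < dim_col M. M $$ (i, j) \<le> K)"

definition self_dual_fishburn_mats :: "nat \<Rightarrow> nat \<Rightarrow> nat mat set" where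
  "self_dual_fishburn_mats K d =
    {M. fishburn M \<and> self_dual M \<and> bounded_entries K M \<and> dim_row M = Suc d}"

definition row_fishburn_mats :: "nat \<Rightarrow> nat \<Rightarrow> nat mat set" where
  "row_fishburn_mats K d = {M. row_fishburn M \<and> bounded_entries K M \<and> dim_row M = Suc d}"

lemma self_dualD:
  assumes "self_dual M" "i < dim_row M" "j < dim_row M"
  shows "M $$ (i, j) = M $$ (dim_row M - 1 - j, dim_row M - 1 - i)"
  using assms unfolding self_dual_def by blast

text \<open>The generating function of a single cell with entry at most \<open>K\<close>, where
  \<open>x\<close> marks the value.\<close>

definition upto_sum :: "nat \<Rightarrow> 'a \<Rightarrow> 'a::comm_ring_1" where
  "upto_sum K x = (\<Sum>a\<le>K. x ^ a)"

text \<open>Since \<open>0 ^ 0 = 1\<close>, substituting 0 for the mark of a cell forces its entry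
  to be zero.\<close>

lemma upto_sum_0 [simp]: "upto_sum K 0 = 1"
  by (induction K) (simp_all add: upto_sum_def)

lemma dvd_upto_sum_minus_one: "x dvd upto_sum K (x * y) - 1"
proof -
  have "upto_sum K (x * y) = 1 + (\<Sum>a<K. (x * y) ^ Suc a)"
    unfolding upto_sum_def lessThan_Suc_atMost[symmetric] sum.lessThan_Suc_shift by simp
  moreover have "x dvd (\<Sum>a<K. (x * y) ^ Suc a)" by (intro dvd_sum) simp
  ultimately show ?thesis by simp
qed

section \<open>Weighted graphs and self-dual Fishburn matrices\<close>

lemma sum_covering_edges:
  fixes x y z w :: "'a::comm_ring_1"
  defines "wt \<equiv> (\<lambda>e::nat \<times> nat. x * (if fst e = 0 \<and> snd e \<noteq> 0 then y else 1) *
      (if fst e = snd e \<and> snd e \<noteq> 0 then z else 1) * (if e = (0, 0) then w else 1))"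
  shows "(\<Sum>f | f \<in> edges_within d {..d} \<rightarrow>\<^sub>E {..K} \<and>
        (\<forall>v\<in>{..d}. \<exists>e\<in>edges_within d {..d}. v \<in> {fst e, snd e} \<and> f e \<noteq> 0).
        \<Prod>e\<in>edges_within d {..d}. wt e ^ f e) =
    upto_sum K (x * w) * cover_poly (upto_sum K x) (upto_sum K (x * z)) d (upto_sum K (x * y)) -
      of_bool (d = 0)"
proof -
  let ?b = "upto_sum K x" and ?z = "upto_sum K (x * z)"
  let ?y = "upto_sum K (x * y)" and ?w = "upto_sum K (x * w)"
  define B where "B = (\<lambda>e. upto_sum K (wt e))"
  define g where "g = (\<lambda>A. (-1) ^ (Suc d + card A) * prod B (edges_within d A))"
  have B: "B e = edge_weight ?b ?z e" if "fst e \<noteq> 0" for e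
    using that by (auto simp: B_def wt_def edge_weight_def split: prod.splits)
  have without0: "g A = (-1) ^ (Suc d + card A) * prod (edge_weight ?b ?z) (edges_within d A)"
    if "A \<subseteq> {1..d}" for A
  proof -
    have "prod B (edges_within d A) = prod (edge_weight ?b ?z) (edges_within d A)"
      using that by (intro prod.cong refl B) (auto simp: edges_within_def)
    thus ?thesis by (simp add: g_def)
  qed
  \<comment> \<open>The loop at 0 is the corner, and the other edges at 0 form the rest of the last
    column, one for each vertex of \<open>A\<close>. The sign of 0 cancels the surplus one in
    \<open>Suc d\<close>.\<close>
  have with0: "g (insert 0 A) =
      ?w * ((-1) ^ d * ((- ?y) ^ card A * prod (edge_weight ?b ?z) (edges_within d A)))"
    if "A \<subseteq> {1..d}" for A
  proof -
    have fin: "finite A" and notin: "0 \<notin> A" using that finite_subset by (blast, auto)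
    have "edges_within d (insert 0 A) = insert (0, 0) (({0} \<times> A) \<union> edges_within d A)"
      using that by (auto simp: edges_within_def)
    moreover have "prod B ({0} \<times> A) = ?y ^ card A"
    proof -
      have "prod B ({0} \<times> A) = (\<Prod>e\<in>{0::nat} \<times> A. ?y)"
        using notin by (intro prod.cong) (auto simp: B_def wt_def)
      thus ?thesis by (simp add: card_cartesian_product)
    qed
    moreover have "prod B (edges_within d A) = prod (edge_weight ?b ?z) (edges_within d A)"
      using that by (intro prod.cong refl B) (auto simp: edges_within_def)
    moreover have "prod B (insert (0, 0) (({0} \<times> A) \<union> edges_within d A)) =
        ?w * (prod B ({0} \<times> A) * prod B (edges_within d A))"
      using notin fin
      by (subst prod.insert, simp, force simp: edges_within_def, subst prod.union_disjoint)
        (auto simp: edges_within_def B_def wt_def finite_edges_within[unfolded edges_within_def])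
    moreover have "(- ?y) ^ card A = (-1) ^ card A * ?y ^ card A" by (rule power_minus)
    ultimately show ?thesis using fin notin by (simp add: g_def power_add mult_ac)
  qed
  have V: "{..d} = insert 0 {1..d}" by auto
  have "(\<Sum>f | f \<in> edges_within d {..d} \<rightarrow>\<^sub>E {..K} \<and>
        (\<forall>v\<in>{..d}. \<exists>e\<in>edges_within d {..d}. v \<in> {fst e, snd e} \<and> f e \<noteq> 0).
        \<Prod>e\<in>edges_within d {..d}. wt e ^ f e) =
    (\<Sum>A\<in>Pow {..d}. (-1) ^ (card {..d} + card A) *
      (\<Prod>e | e \<in> edges_within d {..d} \<and> {fst e, snd e} \<subseteq> A. \<Sum>a\<le>K. wt e ^ a))"
    by (rule sum_covering_weights) (simp_all, auto simp: edges_within_def)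
  also have "\<dots> = sum g (Pow {..d})"
  proof (intro sum.cong refl)
    fix A assume "A \<in> Pow {..d}"
    hence "{e. e \<in> edges_within d {..d} \<and> {fst e, snd e} \<subseteq> A} = edges_within d A"
      by (auto simp: edges_within_def)
    thus "(-1) ^ (card {..d} + card A) *
      (\<Prod>e | e \<in> edges_within d {..d} \<and> {fst e, snd e} \<subseteq> A. \<Sum>a\<le>K. wt e ^ a) = g A"
      by (simp add: g_def B_def upto_sum_def)
  qed
  also have "\<dots> = sum g (Pow {1..d}) + (\<Sum>A\<in>Pow {1..d}. g (insert 0 A))"
    unfolding V by (rule sum_Pow_insert) auto
  also have "(\<Sum>A\<in>Pow {1..d}. g (insert 0 A)) = ?w * cover_poly ?b ?z d ?y"
    unfolding cover_poly_conv_sum sum_distrib_left by (intro sum.cong refl with0) auto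
  \<comment> \<open>Without the vertex 0 its edges are absent, so \<open>Y\<close> becomes 1; the
    missing sign of 0 leaves a minus.\<close>
  also have "sum g (Pow {1..d}) = - cover_poly ?b ?z d 1"
    unfolding cover_poly_conv_sum sum_distrib_left sum_negf[symmetric]
    by (intro sum.cong refl) (auto simp: without0 power_add)
  \<comment> \<open>At 1 the factor \<open>Y - 1\<close> of the recursion vanishes for all
    \<open>d > 0\<close>.\<close>
  also have "cover_poly ?b ?z d 1 = of_bool (d = 0)"
    by (cases "(?b, ?z, d, 1 :: 'a)" rule: cover_poly.cases) auto
  finally show ?thesis by simp
qed

text \<open>Upper triangularity leaves the cells with \<open>i \<le> j\<close>; among the diagonal
  cells and SE-cells these are in bijection with the edges by
  \<open>(i, j) \<mapsto> (d - j, i)\<close>.\<close>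

lemma self_dual_stats:
  assumes M: "M \<in> self_dual_fishburn_mats K d"
  defines "E \<equiv> edges_within d {..d}"
  defines "f \<equiv> (\<lambda>e. M $$ (snd e, d - fst e))"
  shows "reduced_size M = (\<Sum>e\<in>E. f e)"
    and "max_stat M = (\<Sum>e | e \<in> E \<and> fst e = 0 \<and> snd e \<noteq> 0. f e)"
    and "dg_stat M = (\<Sum>e | e \<in> E \<and> fst e = snd e \<and> snd e \<noteq> 0. f e)"
    and "iso_stat M = (\<Sum>e | e \<in> E \<and> e = (0, 0). f e)"
proof -
  have dim: "dim_row M = Suc d" and ut: "\<And>i j. j < i \<Longrightarrow> i \<le> d \<Longrightarrow> M $$ (i, j) = 0"
    using M by (auto simp: self_dual_fishburn_mats_def fishburn_def)
  hence ut': "\<And>i j. M $$ (i, j) > 0 \<Longrightarrow> i < Suc d \<Longrightarrow> i \<le> j"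
    by (metis less_Suc_eq_le not_le less_irrefl)
  have "reduced_size M = (\<Sum>c\<in>{(i, j). i \<le> j \<and> j \<le> d \<and> d \<le> i + j}. M $$ c)"
    unfolding reduced_size_def
  proof (rule sum.mono_neutral_right)
    show "finite (diagonal_cells M \<union> SE_cells M)"
      by (rule finite_subset[of _ "{..d} \<times> {..d}"])
        (auto simp: diagonal_cells_def SE_cells_def dim)
  qed (auto simp: diagonal_cells_def SE_cells_def dim intro: ut')
  also have "\<dots> = (\<Sum>e\<in>E. f e)"
    by (rule sum.reindex_bij_witness[of _ "\<lambda>(l, i). (i, d - l)" "\<lambda>(i, j). (d - j, i)"])
      (auto simp: E_def f_def edges_within_def)
  finally show "reduced_size M = (\<Sum>e\<in>E. f e)" .
  show "max_stat M = (\<Sum>e | e \<in> E \<and> fst e = 0 \<and> snd e \<noteq> 0. f e)"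
    unfolding max_stat_def dim
    by (rule sum.reindex_bij_witness[of _ snd "\<lambda>i. (0, i)"])
      (auto simp: E_def f_def edges_within_def)
  have "dg_stat M = (\<Sum>c\<in>{(i, j). i \<le> j \<and> i \<noteq> 0 \<and> d = i + j}. M $$ c)"
    unfolding dg_stat_def
  proof (rule sum.mono_neutral_right)
    show "finite (diagonal_cells M - {corner_cell M})"
      by (rule finite_subset[of _ "{..d} \<times> {..d}"]) (auto simp: diagonal_cells_def dim)
  qed (auto simp: diagonal_cells_def corner_cell_def dim intro: ut')
  also have "\<dots> = (\<Sum>e | e \<in> E \<and> fst e = snd e \<and> snd e \<noteq> 0. f e)"
    by (rule sum.reindex_bij_witness[of _ "\<lambda>(l, i). (i, d - l)" "\<lambda>(i, j). (i, i)"])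
      (auto simp: E_def f_def edges_within_def)
  finally show "dg_stat M = (\<Sum>e | e \<in> E \<and> fst e = snd e \<and> snd e \<noteq> 0. f e)" .
  have "{e. e \<in> E \<and> e = (0, 0)} = {(0, 0)}" by (auto simp: E_def edges_within_def)
  thus "iso_stat M = (\<Sum>e | e \<in> E \<and> e = (0, 0). f e)"
    by (simp add: iso_stat_def corner_cell_def f_def dim)
qed

text \<open>The dual cells \<open>(i, j)\<close> and \<open>(d - j, d - i)\<close> belong to the
  same edge, so self-dual upper-triangular matrices correspond to fillings of the edges, and row
  \<open>v\<close> is nonzero iff the vertex \<open>v\<close> is covered.\<close>

lemma self_dual_fishburn_gf:
  fixes x y z w :: "'a::comm_ring_1"
  shows "(\<Sum>M\<in>self_dual_fishburn_mats K d.
      x ^ reduced_size M * y ^ max_stat M * z ^ dg_stat M * w ^ iso_stat M) =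
    upto_sum K (x * w) * cover_poly (upto_sum K x) (upto_sum K (x * z)) d (upto_sum K (x * y)) -
      of_bool (d = 0)"
proof -
  let ?E = "edges_within d {..d}"
  have fin: "finite ?E" by simp
  define wt where "wt = (\<lambda>e::nat \<times> nat. x * (if fst e = 0 \<and> snd e \<noteq> 0 then y else 1) *
      (if fst e = snd e \<and> snd e \<noteq> 0 then z else 1) * (if e = (0, 0) then w else 1))"
  define F where "F = {f. f \<in> ?E \<rightarrow>\<^sub>E {..K} \<and>
        (\<forall>v\<in>{..d}. \<exists>e\<in>?E. v \<in> {fst e, snd e} \<and> f e \<noteq> 0)}"
  \<comment> \<open>The ends of an edge are the row index and the reflected column index;
    \<open>min\<close> and \<open>max\<close> put them in the order required by
    \<open>edges_within\<close>.\<close>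
  define toM where "toM = (\<lambda>f::nat \<times> nat \<Rightarrow> nat. mat (Suc d) (Suc d)
      (\<lambda>(i, j). if i \<le> j then f (min i (d - j), max i (d - j)) else 0))"
  define toF where "toF = (\<lambda>M::nat mat. restrict (\<lambda>e. M $$ (snd e, d - fst e)) ?E)"
  have in_E: "(min i (d - j), max i (d - j)) \<in> ?E" if "i \<le> j" "j \<le> d" for i j
    using that by (auto simp: edges_within_def min_def max_def)
  have entry: "toF M (min i (d - j), max i (d - j)) = M $$ (i, j)"
    if M: "M \<in> self_dual_fishburn_mats K d" and ij: "i \<le> j" "j \<le> d" for M i j
  proof -
    have "self_dual M" "dim_row M = Suc d" using M by (auto simp: self_dual_fishburn_mats_def)
    hence "M $$ (i, j) = M $$ (d - j, d - i)" using self_dualD[of M i j] ij by simp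
    thus ?thesis using in_E[OF ij] ij by (auto simp: toF_def min_def max_def)
  qed
  have "(\<Sum>M\<in>self_dual_fishburn_mats K d.
      x ^ reduced_size M * y ^ max_stat M * z ^ dg_stat M * w ^ iso_stat M) =
    (\<Sum>f\<in>F. \<Prod>e\<in>?E. wt e ^ f e)"
  proof (rule sum.reindex_bij_witness[of _ toM toF])
    fix M assume M: "M \<in> self_dual_fishburn_mats K d"
    have dim: "dim_row M = Suc d" "dim_col M = Suc d"
      and ut: "\<And>i j. j < i \<Longrightarrow> i \<le> d \<Longrightarrow> M $$ (i, j) = 0"
      using M by (auto simp: self_dual_fishburn_mats_def fishburn_def)
    show "toM (toF M) = M"
      by (rule eq_matI) (auto simp: toM_def dim entry[OF M] ut)
    have "toF M e \<le> K" if "e \<in> ?E" for e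
      using that M by (auto simp: toF_def edges_within_def dim bounded_entries_def self_dual_fishburn_mats_def)
    moreover have "\<exists>e\<in>?E. v \<in> {fst e, snd e} \<and> toF M e \<noteq> 0" if "v \<le> d" for v
    proof -
      have "\<exists>j<dim_col M. M $$ (v, j) \<noteq> 0" if "v < dim_row M" for v
        using M that unfolding self_dual_fishburn_mats_def fishburn_def by blast
      from this[of v] that obtain j where j: "j \<le> d" "M $$ (v, j) \<noteq> 0"
        unfolding dim less_Suc_eq_le by blast
      hence "v \<le> j" using ut that by (meson not_le)
      with j show ?thesis
        by (intro bexI[of _ "(min v (d - j), max v (d - j))"])
          (use in_E[of v j] entry[OF M, of v j] \<open>v \<le> j\<close> in \<open>auto simp: min_def max_def split: if_splits\<close>)
    qed
    ultimately show "toF M \<in> F" by (auto simp: F_def toF_def)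
    have "(\<Prod>e\<in>?E. wt e ^ toF M e) = (\<Prod>e\<in>?E. wt e ^ (M $$ (snd e, d - fst e)))"
      by (intro prod.cong) (auto simp: toF_def)
    thus "(\<Prod>e\<in>?E. wt e ^ toF M e) =
        x ^ reduced_size M * y ^ max_stat M * z ^ dg_stat M * w ^ iso_stat M"
      unfolding wt_def prod_class_weights[OF fin] self_dual_stats[OF M] .
  next
    fix f assume f: "f \<in> F"
    hence fE: "f \<in> ?E \<rightarrow>\<^sub>E {..K}"
      and cov: "\<And>v. v \<in> {..d} \<Longrightarrow> \<exists>e\<in>?E. v \<in> {fst e, snd e} \<and> f e \<noteq> 0"
      unfolding F_def by blast+
    show "toF (toM f) = f"
    proof
      fix e
      show "toF (toM f) e = f e"
      proof (cases "e \<in> ?E")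
        case True
        then obtain l i where e: "e = (l, i)" "l \<le> i" "l + i \<le> d" by (auto simp: edges_within_def)
        have "min i (d - (d - l)) = l" "max i (d - (d - l)) = i" using e by auto
        with True show ?thesis using e by (auto simp: toF_def toM_def)
      next
        case False
        have "f e = undefined" by (rule PiE_arb[OF fE False])
        with False show ?thesis by (simp add: toF_def)
      qed
    qed
    let ?M = "toM f"
    have dim: "dim_row ?M = Suc d" "dim_col ?M = Suc d" by (simp_all add: toM_def)
    have sd: "?M $$ (i, j) = ?M $$ (d - j, d - i)" if "i \<le> d" "j \<le> d" for i j
      using that by (auto simp: toM_def min.commute max.commute)
    have row: "\<exists>j\<le>d. ?M $$ (v, j) \<noteq> 0" if v: "v \<le> d" for v
    proof -
      obtain l i where e: "l \<le> i" "l + i \<le> d" "v = l \<or> v = i" "f (l, i) \<noteq> 0"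
        using cov[of v] v by (auto simp: edges_within_def)
      have "?M $$ (i, d - l) = f (l, i)" "?M $$ (l, d - i) = f (l, i)"
        using e(1,2) by (auto simp: toM_def min_def max_def)
      with e show ?thesis by (metis diff_le_self)
    qed
    \<comment> \<open>Column \<open>j\<close> is dual to row \<open>d - j\<close>.\<close>
    have col: "\<exists>i\<le>d. ?M $$ (i, j) \<noteq> 0" if "j \<le> d" for j
    proof -
      obtain j' where "j' \<le> d" "?M $$ (d - j, j') \<noteq> 0" using row[of "d - j"] by auto
      with sd[of "d - j" j'] that show ?thesis by (metis diff_diff_cancel diff_le_self)
    qed
    have "?M $$ (i, j) \<le> K" if "i \<le> d" "j \<le> d" for i j
      using PiE_mem[OF fE in_E[of i j]] that by (simp add: toM_def)
    hence "bounded_entries K ?M" by (simp add: bounded_entries_def dim less_Suc_eq_le)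
    moreover have "upper_triangular ?M" by (auto simp: toM_def)
    hence "fishburn ?M" using row col by (auto simp: fishburn_def dim less_Suc_eq_le)
    moreover have "self_dual ?M"
      unfolding self_dual_def dim
    proof (intro conjI allI impI)
      fix i j assume "i < Suc d" "j < Suc d"
      thus "?M $$ (i, j) = ?M $$ (Suc d - 1 - j, Suc d - 1 - i)" using sd[of i j] by simp
    qed (simp add: dim)
    ultimately show "?M \<in> self_dual_fishburn_mats K d"
      by (simp add: self_dual_fishburn_mats_def dim)
  qed
  also have "\<dots> = upto_sum K (x * w) *
      cover_poly (upto_sum K x) (upto_sum K (x * z)) d (upto_sum K (x * y)) - of_bool (d = 0)"
    unfolding F_def wt_def by (rule sum_covering_edges)
  finally show ?thesis .
qed

section \<open>Row-Fishburn matrices as sequences of independent rows\<close>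

lemma sum_covering_rows:
  fixes x y z w :: "'a::comm_ring_1"
  defines "wt \<equiv> (\<lambda>d e. x * (if snd e = d \<and> fst e \<noteq> 0 then y else 1) *
      (if fst e = 0 \<and> snd e \<noteq> d then z else 1) * (if e = (0, d) then w else 1))"
  defines "E \<equiv> (\<lambda>d. SIGMA i:{..d::nat}. {i..d})"
  shows "(\<Sum>f | f \<in> E d \<rightarrow>\<^sub>E {..K} \<and> (\<forall>v\<in>{..d}. \<exists>e\<in>E d. v \<in> {fst e} \<and> f e \<noteq> 0).
        \<Prod>e\<in>E d. wt d e ^ f e) =
    (upto_sum K (x * w) * upto_sum K (x * z) ^ d - 1) * row_poly (upto_sum K x) d (upto_sum K (x * y))"
proof -
  let ?b = "upto_sum K x" and ?z = "upto_sum K (x * z)"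
  let ?y = "upto_sum K (x * y)" and ?w = "upto_sum K (x * w)"
  define r where "r = (\<lambda>i. \<Prod>j\<in>{i..d}. upto_sum K (wt d (i, j)))"
  have r0: "r 0 = ?w * ?z ^ d"
  proof -
    have "{0..d} = insert d {..<d}" by auto
    hence "r 0 = upto_sum K (wt d (0, d)) * (\<Prod>j<d. upto_sum K (wt d (0, j)))" by (simp add: r_def)
    thus ?thesis by (simp add: wt_def)
  qed
  have rpos: "r i = ?b ^ (d - i) * ?y" if "0 < i" "i \<le> d" for i
  proof -
    have "{i..d} = insert d {i..<d}" using that by auto
    hence "r i = upto_sum K (wt d (i, d)) * (\<Prod>j\<in>{i..<d}. upto_sum K (wt d (i, j)))"
      by (simp add: r_def)
    thus ?thesis using that by (simp add: wt_def)
  qed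
  have "(\<Sum>f | f \<in> E d \<rightarrow>\<^sub>E {..K} \<and> (\<forall>v\<in>{..d}. \<exists>e\<in>E d. v \<in> {fst e} \<and> f e \<noteq> 0).
        \<Prod>e\<in>E d. wt d e ^ f e) =
    (\<Sum>A\<in>Pow {..d}. (-1) ^ (card {..d} + card A) *
      (\<Prod>e | e \<in> E d \<and> {fst e} \<subseteq> A. \<Sum>a\<le>K. wt d e ^ a))"
    by (rule sum_covering_weights) (auto simp: E_def)
  \<comment> \<open>Every cell lies in exactly one row, so the weight of \<open>A\<close> splits
    into rows. The product of ones, standing for the zero rows, gives the shape of
    \<open>prod_diff_expand\<close>.\<close>
  also have "\<dots> = (\<Sum>A\<in>Pow {..d}. (-1) ^ (card {..d} + card A) * (\<Prod>i\<in>A. r i) * (\<Prod>i\<in>{..d} - A. 1))"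
  proof (intro sum.cong refl)
    fix A assume "A \<in> Pow {..d}"
    hence "{e. e \<in> E d \<and> {fst e} \<subseteq> A} = (SIGMA i:A. {i..d})" and "finite A"
      by (auto simp: E_def finite_subset)
    moreover from \<open>finite A\<close> have "(\<Prod>i\<in>A. r i) = (\<Prod>e\<in>(SIGMA i:A. {i..d}). upto_sum K (wt d e))"
      unfolding r_def by (subst prod.Sigma) auto
    ultimately show "(-1) ^ (card {..d} + card A) *
        (\<Prod>e | e \<in> E d \<and> {fst e} \<subseteq> A. \<Sum>a\<le>K. wt d e ^ a) =
        (-1) ^ (card {..d} + card A) * (\<Prod>i\<in>A. r i) * (\<Prod>i\<in>{..d} - A. 1)"
      by (simp add: upto_sum_def)
  qed
  also have "\<dots> = (\<Prod>i\<in>{..d}. r i - 1)" by (simp only: prod_diff_expand[OF finite_atMost])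
  also have "\<dots> = (r 0 - 1) * (\<Prod>i<d. r (Suc i) - 1)"
    unfolding lessThan_Suc_atMost[symmetric] prod.lessThan_Suc_shift ..
  also have "(\<Prod>i<d. r (Suc i) - 1) = (\<Prod>i<d. ?b ^ (d - Suc i) * ?y - 1)"
    by (intro prod.cong) (auto simp: rpos)
  \<comment> \<open>The number of generic cells decreases from top to bottom while
    \<open>row_poly\<close> counts upwards, so the product is reversed.\<close>
  also have "\<dots> = row_poly ?b d ?y"
    unfolding row_poly_def by (rule prod.nat_diff_reindex)
  finally show ?thesis by (simp add: r0)
qed

lemma row_stats:
  assumes M: "M \<in> row_fishburn_mats K d"
  defines "E \<equiv> SIGMA i:{..d}. {i..d}"
  shows "mat_size M = (\<Sum>e\<in>E. M $$ e)"
    and "max_stat M = (\<Sum>e | e \<in> E \<and> snd e = d \<and> fst e \<noteq> 0. M $$ e)"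
    and "min_stat M = (\<Sum>e | e \<in> E \<and> fst e = 0 \<and> snd e \<noteq> d. M $$ e)"
    and "iso_stat M = (\<Sum>e | e \<in> E \<and> e = (0, d). M $$ e)"
proof -
  have dim: "dim_row M = Suc d" "dim_col M = Suc d"
    and ut: "\<And>i j. j < i \<Longrightarrow> i \<le> d \<Longrightarrow> M $$ (i, j) = 0"
    using M by (auto simp: row_fishburn_mats_def row_fishburn_def)
  have "mat_size M = (\<Sum>i\<le>d. \<Sum>j\<in>{i..d}. M $$ (i, j))"
    unfolding mat_size_def dim lessThan_Suc_atMost
    by (intro sum.cong refl sum.mono_neutral_right) (auto simp: ut)
  thus "mat_size M = (\<Sum>e\<in>E. M $$ e)" unfolding E_def by (subst (asm) sum.Sigma) auto
  show "max_stat M = (\<Sum>e | e \<in> E \<and> snd e = d \<and> fst e \<noteq> 0. M $$ e)"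
    unfolding max_stat_def dim
    by (rule sum.reindex_bij_witness[of _ fst "\<lambda>i. (i, d)"]) (auto simp: E_def)
  show "min_stat M = (\<Sum>e | e \<in> E \<and> fst e = 0 \<and> snd e \<noteq> d. M $$ e)"
    unfolding min_stat_def dim
    by (rule sum.reindex_bij_witness[of _ snd "\<lambda>j. (0, j)"]) (auto simp: E_def)
  have "{e. e \<in> E \<and> e = (0, d)} = {(0, d)}" by (auto simp: E_def)
  thus "iso_stat M = (\<Sum>e | e \<in> E \<and> e = (0, d). M $$ e)"
    by (simp add: iso_stat_def corner_cell_def dim)
qed

lemma row_fishburn_gf:
  fixes x y z w :: "'a::comm_ring_1"
  shows "(\<Sum>M\<in>row_fishburn_mats K d.
      x ^ mat_size M * y ^ max_stat M * z ^ min_stat M * w ^ iso_stat M) =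
    (upto_sum K (x * w) * upto_sum K (x * z) ^ d - 1) * row_poly (upto_sum K x) d (upto_sum K (x * y))"
proof -
  let ?E = "SIGMA i:{..d}. {i..d}"
  have fin: "finite ?E" by simp
  define wt where "wt = (\<lambda>e::nat \<times> nat. x * (if snd e = d \<and> fst e \<noteq> 0 then y else 1) *
      (if fst e = 0 \<and> snd e \<noteq> d then z else 1) * (if e = (0, d) then w else 1))"
  define F where "F = {f. f \<in> ?E \<rightarrow>\<^sub>E {..K} \<and> (\<forall>v\<in>{..d}. \<exists>e\<in>?E. v \<in> {fst e} \<and> f e \<noteq> 0)}"
  define toM where "toM = (\<lambda>f::nat \<times> nat \<Rightarrow> nat. mat (Suc d) (Suc d)
      (\<lambda>(i, j). if i \<le> j then f (i, j) else 0))"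
  define toF where "toF = (\<lambda>M::nat mat. restrict (\<lambda>e. M $$ e) ?E)"
  have "(\<Sum>M\<in>row_fishburn_mats K d.
      x ^ mat_size M * y ^ max_stat M * z ^ min_stat M * w ^ iso_stat M) =
    (\<Sum>f\<in>F. \<Prod>e\<in>?E. wt e ^ f e)"
  proof (rule sum.reindex_bij_witness[of _ toM toF])
    fix M assume M: "M \<in> row_fishburn_mats K d"
    have dim: "dim_row M = Suc d" "dim_col M = Suc d"
      and ut: "\<And>i j. j < i \<Longrightarrow> i \<le> d \<Longrightarrow> M $$ (i, j) = 0"
      using M by (auto simp: row_fishburn_mats_def row_fishburn_def)
    show "toM (toF M) = M"
      by (rule eq_matI) (auto simp: toM_def toF_def dim ut)
    have "toF M e \<le> K" if "e \<in> ?E" for e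
      using that M by (auto simp: toF_def dim bounded_entries_def row_fishburn_mats_def)
    moreover have "\<exists>e\<in>?E. v \<in> {fst e} \<and> toF M e \<noteq> 0" if "v \<le> d" for v
    proof -
      have "\<exists>j<dim_col M. M $$ (v, j) \<noteq> 0" if "v < dim_row M" for v
        using M that unfolding row_fishburn_mats_def row_fishburn_def by blast
      from this[of v] that obtain j where j: "j \<le> d" "M $$ (v, j) \<noteq> 0"
        unfolding dim less_Suc_eq_le by blast
      hence "v \<le> j" using ut that by (meson not_le)
      with j show ?thesis by (intro bexI[of _ "(v, j)"]) (auto simp: toF_def)
    qed
    ultimately show "toF M \<in> F" by (auto simp: F_def toF_def)
    have "(\<Prod>e\<in>?E. wt e ^ toF M e) = (\<Prod>e\<in>?E. wt e ^ (M $$ e))"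
      by (intro prod.cong) (auto simp: toF_def)
    thus "(\<Prod>e\<in>?E. wt e ^ toF M e) =
        x ^ mat_size M * y ^ max_stat M * z ^ min_stat M * w ^ iso_stat M"
      unfolding wt_def prod_class_weights[OF fin] row_stats[OF M] .
  next
    fix f assume f: "f \<in> F"
    hence fE: "f \<in> ?E \<rightarrow>\<^sub>E {..K}"
      and cov: "\<And>v. v \<in> {..d} \<Longrightarrow> \<exists>e\<in>?E. v \<in> {fst e} \<and> f e \<noteq> 0"
      unfolding F_def by blast+
    have "toF (toM f) e = f e" for e
    proof (cases "e \<in> ?E")
      case False
      have "f e = undefined" by (rule PiE_arb[OF fE False])
      with False show ?thesis by (simp add: toF_def)
    qed (auto simp: toF_def toM_def)
    thus "toF (toM f) = f" by (rule ext)
    let ?M = "toM f"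
    have dim: "dim_row ?M = Suc d" "dim_col ?M = Suc d" by (simp_all add: toM_def)
    have row: "\<exists>j\<le>d. ?M $$ (v, j) \<noteq> 0" if v: "v \<le> d" for v
    proof -
      obtain j where "v \<le> j" "j \<le> d" "f (v, j) \<noteq> 0" using cov[of v] v by auto
      thus ?thesis by (intro exI[of _ j]) (auto simp: toM_def)
    qed
    have "?M $$ (i, j) \<le> K" if "i \<le> d" "j \<le> d" for i j
      using PiE_mem[OF fE, of "(i, j)"] that by (simp add: toM_def)
    hence "bounded_entries K ?M" by (simp add: bounded_entries_def dim less_Suc_eq_le)
    moreover have "upper_triangular ?M" by (auto simp: toM_def)
    hence "row_fishburn ?M" using row by (auto simp: row_fishburn_def dim less_Suc_eq_le)
    ultimately show "?M \<in> row_fishburn_mats K d" by (simp add: row_fishburn_mats_def dim)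
  qed
  also have "\<dots> = (upto_sum K (x * w) * upto_sum K (x * z) ^ d - 1) *
      row_poly (upto_sum K x) d (upto_sum K (x * y))"
    unfolding F_def wt_def by (rule sum_covering_rows)
  finally show ?thesis .
qed

text \<open>Both series reduce to \<open>P\<close>: \<open>S z w\<close> is congruent to
  \<open>upto_sum K (x * w) * P (upto_sum K (x * z)) - 1\<close>, and \<open>T z w\<close> equals
  the same product minus \<open>P 1\<close>. The cutoffs differ because self-dual matrices gain a
  factor \<open>x\<close> only every two dimensions.\<close>

lemma self_dual_gf_congruence:
  fixes x y z w :: "'a::comm_ring_1" and K n :: nat
  defines "S \<equiv> (\<lambda>z w. \<Sum>d<2 * Suc n. \<Sum>M\<in>self_dual_fishburn_mats K d.
    x ^ reduced_size M * y ^ max_stat M * z ^ dg_stat M * w ^ iso_stat M)"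
  defines "T \<equiv> (\<lambda>z w. \<Sum>d<Suc n. \<Sum>M\<in>row_fishburn_mats K d.
    x ^ mat_size M * y ^ max_stat M * z ^ min_stat M * w ^ iso_stat M)"
  shows "x ^ Suc n dvd S z w - S 0 0 - T z w" and "x ^ Suc n dvd S 0 0 - T 1 y"
proof -
  define b where "b = upto_sum K x"
  define Y where "Y = upto_sum K (x * y)"
  define P where "P = (\<lambda>z. \<Sum>k<Suc n. z ^ k * row_poly b k Y)"
  have b: "x dvd b - 1" and Y: "x dvd Y - 1"
    using dvd_upto_sum_minus_one[of x K 1] dvd_upto_sum_minus_one[of x K y] by (simp_all add: b_def Y_def)
  have S: "x ^ Suc n dvd S z w - (upto_sum K (x * w) * P (upto_sum K (x * z)) - 1)" for z w
  proof -
    have "(\<Sum>d<2 * Suc n. of_bool (d = 0)) = (1::'a)"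
      unfolding of_bool_def by (subst sum.delta) auto
    hence "S z w = upto_sum K (x * w) *
        (\<Sum>d<2 * Suc n. cover_poly b (upto_sum K (x * z)) d Y) - 1"
      by (simp only: S_def self_dual_fishburn_gf b_def Y_def sum_subtractf sum_distrib_left)
    hence "S z w - (upto_sum K (x * w) * P (upto_sum K (x * z)) - 1) = upto_sum K (x * w) *
        ((\<Sum>d<2 * Suc n. cover_poly b (upto_sum K (x * z)) d Y) - P (upto_sum K (x * z)))"
      by (simp only: right_diff_distrib) (simp only: diff_diff_eq2 diff_add_cancel)
    thus ?thesis unfolding P_def using cover_poly_sum_cong[OF b Y] by (simp only: dvd_mult)
  qed
  have T: "T z w = upto_sum K (x * w) * P (upto_sum K (x * z)) - P 1" for z w
    unfolding T_def row_fishburn_gf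
    by (simp add: b_def Y_def P_def sum_distrib_left sum_subtractf
        left_diff_distrib mult.assoc del: sum.lessThan_Suc)
  have "S z w - S 0 0 - T z w = (S z w - (upto_sum K (x * w) * P (upto_sum K (x * z)) - 1)) -
      (S 0 0 - (upto_sum K (x * 0) * P (upto_sum K (x * 0)) - 1))"
    unfolding T by simp
  thus "x ^ Suc n dvd S z w - S 0 0 - T z w" by (simp only: dvd_diff S)
  \<comment> \<open>For \<open>z = 1\<close> and \<open>w = y\<close> the first row has
    \<open>d\<close> generic cells and one cell of weight \<open>Y\<close>, so it supplies the next
    factor of \<open>row_poly\<close>.\<close>
  have "T 1 y = (\<Sum>k<Suc n. row_poly b (Suc k) Y)"
    unfolding T_def row_fishburn_gf
    by (simp add: row_poly_def b_def Y_def mult_ac del: sum.lessThan_Suc)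
  also have "\<dots> = P 1 - 1 + row_poly b (Suc n) Y"
  proof -
    have "(\<Sum>k<Suc (Suc n). row_poly b k Y) = 1 + (\<Sum>k<Suc n. row_poly b (Suc k) Y)"
      by (simp only: sum.lessThan_Suc_shift row_poly_0)
    moreover have "(\<Sum>k<Suc (Suc n). row_poly b k Y) = P 1 + row_poly b (Suc n) Y"
      by (simp add: P_def)
    ultimately show ?thesis by (simp add: algebra_simps)
  qed
  finally have "S 0 0 - T 1 y =
      (S 0 0 - (upto_sum K (x * 0) * P (upto_sum K (x * 0)) - 1)) - row_poly b (Suc n) Y"
    by simp
  thus "x ^ Suc n dvd S 0 0 - T 1 y" by (simp only: dvd_diff S power_dvd_row_poly[OF b Y])
qed

section \<open>Extraction of coefficients\<close>

type_synonym poly4 = "int poly poly poly poly"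

text \<open>\<open>var1\<close> marks the size. As it is the outermost variable, divisibility by
  \<open>var1 ^ N\<close> concerns only the outer coefficients below \<open>N\<close>.\<close>

definition var1 :: poly4 where "var1 = monom 1 1"
definition var2 :: poly4 where "var2 = monom (monom 1 1) 0"
definition var3 :: poly4 where "var3 = monom (monom (monom 1 1) 0) 0"
definition var4 :: poly4 where "var4 = monom (monom (monom (monom 1 1) 0) 0) 0"

definition coeff4 :: "poly4 \<Rightarrow> nat \<Rightarrow> nat \<Rightarrow> nat \<Rightarrow> nat \<Rightarrow> int" where
  "coeff4 f n m p q = coeff (coeff (coeff (coeff f n) m) p) q"

lemma coeff4_diff [simp]: "coeff4 (f - g) n m p q = coeff4 f n m p q - coeff4 g n m p q"
  by (simp add: coeff4_def)

lemma coeff4_sum [simp]: "coeff4 (\<Sum>i\<in>I. f i) n m p q = (\<Sum>i\<in>I. coeff4 (f i) n m p q)"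
  by (simp add: coeff4_def coeff_sum)

lemma coeff4_eq_0_if_power_dvd:
  assumes "var1 ^ N dvd f" "n < N"
  shows "coeff4 f n m p q = 0"
proof -
  have "var1 ^ N = monom 1 N" by (simp add: var1_def monom_power)
  thus ?thesis using assms monom_1_dvd_iff'[of N f] by (simp add: coeff4_def)
qed

lemma coeff4_monom:
  "coeff4 (var1 ^ a * var2 ^ b * var3 ^ c * var4 ^ d) n m p q =
    of_bool (a = n \<and> b = m \<and> c = p \<and> d = q)"
proof -
  have "var1 ^ a * var2 ^ b * var3 ^ c * var4 ^ d = monom (monom (monom (monom 1 d) c) b) a"
    by (simp add: var1_def var2_def var3_def var4_def monom_power mult_monom)
  thus ?thesis by (auto simp: coeff4_def)
qed

lemma coeff4_gf:
  assumes "finite S"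
  shows "coeff4 (\<Sum>M\<in>S. var1 ^ a M * var2 ^ b M * var3 ^ c M * var4 ^ d M) n m p q =
    int (card {M \<in> S. a M = n \<and> b M = m \<and> c M = p \<and> d M = q})"
  unfolding coeff4_sum coeff4_monom of_bool_def sum.inter_filter[OF assms, symmetric] by simp

section \<open>Finiteness and bounds on the dimension\<close>

lemma finite_bounded_mats:
  "finite {M. dim_row M = n \<and> dim_col M = m \<and> bounded_entries K M}" (is "finite ?S")
proof (rule finite_subset)
  let ?I = "{..<n} \<times> {..<m}"
  show "?S \<subseteq> mat n m ` (?I \<rightarrow>\<^sub>E {..K})"
  proof
    fix M assume "M \<in> ?S"
    hence "M = mat n m (restrict (($$) M) ?I)" "restrict (($$) M) ?I \<in> ?I \<rightarrow>\<^sub>E {..K}"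
      by (auto simp: bounded_entries_def intro!: eq_matI)
    thus "M \<in> mat n m ` (?I \<rightarrow>\<^sub>E {..K})" by blast
  qed
  show "finite (mat n m ` (?I \<rightarrow>\<^sub>E {..K}))" by (simp add: finite_PiE)
qed

lemma finite_self_dual_fishburn_mats [simp]: "finite (self_dual_fishburn_mats K d)"
  by (rule finite_subset[OF _ finite_bounded_mats[of "Suc d" "Suc d" K]])
    (auto simp: self_dual_fishburn_mats_def fishburn_def)

lemma finite_row_fishburn_mats [simp]: "finite (row_fishburn_mats K d)"
  by (rule finite_subset[OF _ finite_bounded_mats[of "Suc d" "Suc d" K]])
    (auto simp: row_fishburn_mats_def row_fishburn_def)

text \<open>For \<open>d > 0\<close> the generating function is divisible by
  \<open>var1 ^ (Suc d div 2)\<close>. For a smaller reduced size the number of matrices sharing all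
  statistics with \<open>M\<close> would be zero, although \<open>M\<close> is one of them.\<close>

lemma self_dual_dim_le:
  assumes "M \<in> self_dual_fishburn_mats K d"
  shows "d \<le> 2 * reduced_size M"
proof (rule ccontr)
  assume "\<not> d \<le> 2 * reduced_size M"
  hence d: "d \<noteq> 0" "reduced_size M < Suc d div 2" by auto
  let ?f = "\<Sum>M\<in>self_dual_fishburn_mats K d. var1 ^ reduced_size M * var2 ^ max_stat M *
    var3 ^ dg_stat M * var4 ^ iso_stat M"
  let ?S = "{M' \<in> self_dual_fishburn_mats K d. reduced_size M' = reduced_size M \<and>
    max_stat M' = max_stat M \<and> dg_stat M' = dg_stat M \<and> iso_stat M' = iso_stat M}"
  have "var1 ^ (Suc d div 2) dvd ?f"
    unfolding self_dual_fishburn_gf using d(1) dvd_upto_sum_minus_one[of var1 K 1]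
    by (simp add: power_dvd_cover_poly dvd_upto_sum_minus_one)
  from coeff4_eq_0_if_power_dvd[OF this d(2)] have "card ?S = 0"
    unfolding coeff4_gf[OF finite_self_dual_fishburn_mats] of_nat_eq_0_iff .
  hence "?S = {}" by (subst (asm) card_0_eq) simp_all
  moreover have "M \<in> ?S" using assms by simp
  ultimately show False by (simp only: empty_iff)
qed

lemma row_dim_le:
  assumes "M \<in> row_fishburn_mats K d"
  shows "d \<le> mat_size M"
proof (rule ccontr)
  assume "\<not> d \<le> mat_size M"
  hence d: "mat_size M < d" by auto
  let ?f = "\<Sum>M\<in>row_fishburn_mats K d. var1 ^ mat_size M * var2 ^ max_stat M *
    var3 ^ min_stat M * var4 ^ iso_stat M"
  let ?S = "{M' \<in> row_fishburn_mats K d. mat_size M' = mat_size M \<and>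
    max_stat M' = max_stat M \<and> min_stat M' = min_stat M \<and> iso_stat M' = iso_stat M}"
  have "var1 ^ d dvd ?f"
    unfolding row_fishburn_gf using dvd_upto_sum_minus_one[of var1 K 1]
    by (simp add: power_dvd_row_poly dvd_upto_sum_minus_one)
  from coeff4_eq_0_if_power_dvd[OF this d] have "card ?S = 0"
    unfolding coeff4_gf[OF finite_row_fishburn_mats] of_nat_eq_0_iff .
  hence "?S = {}" by (subst (asm) card_0_eq) simp_all
  moreover have "M \<in> ?S" using assms by simp
  ultimately show False by (simp only: empty_iff)
qed

lemma last_col_sum_conv:
  assumes "dim_row M > 0"
  shows "last_col_sum M = max_stat M + iso_stat M"
  unfolding last_col_sum_def max_stat_def iso_stat_def corner_cell_def
  using assms by (subst sum.remove[of _ 0]) auto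

lemma diagonal_zero_conv:
  assumes "dim_row M > 0"
  shows "diagonal_zero M \<longleftrightarrow> dg_stat M = 0 \<and> iso_stat M = 0"
proof -
  have "finite (diagonal_cells M)"
    by (rule finite_subset[of _ "{..<dim_row M} \<times> {..<dim_row M}"]) (auto simp: diagonal_cells_def)
  moreover have "corner_cell M \<in> diagonal_cells M"
    using assms by (simp add: corner_cell_def diagonal_cells_def)
  ultimately show ?thesis by (auto simp: diagonal_zero_def dg_stat_def iso_stat_def)
qed

text \<open>Coefficients are compared for three substitutions: \<open>0\<close> and \<open>0\<close>
  select the zero diagonals, \<open>1\<close> and \<open>var2\<close> merge the corner with the rest
  of the last column, \<open>var3\<close> and \<open>var4\<close> keep all statistics.\<close>

lemma bounded_counts:
  fixes K n m p q :: nat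
  defines "sd \<equiv> (\<lambda>M. fishburn M \<and> self_dual M \<and> bounded_entries K M)"
  defines "rf \<equiv> (\<lambda>N. row_fishburn N \<and> bounded_entries K N)"
  shows "card {M. sd M \<and> reduced_size M = n \<and> last_col_sum M = m \<and> diagonal_zero M} =
      card {N. rf N \<and> mat_size N = n \<and> last_col_sum N = m}" (is ?zero)
    and "card {M. sd M \<and> reduced_size M = n \<and> last_col_sum M = m \<and> \<not> diagonal_zero M} =
      card {N. rf N \<and> mat_size N = n \<and> last_col_sum N = m}" (is ?nonzero)
    and "p + q \<ge> 1 \<Longrightarrow>
      card {M. sd M \<and> reduced_size M = n \<and> max_stat M = m \<and> dg_stat M = p \<and> iso_stat M = q} =
      card {N. rf N \<and> mat_size N = n \<and> max_stat N = m \<and> min_stat N = p \<and> iso_stat N = q}"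
proof -
  define U where "U = (\<Union>d<2 * Suc n. self_dual_fishburn_mats K d)"
  define V where "V = (\<Union>d<Suc n. row_fishburn_mats K d)"
  define S where "S = (\<lambda>z w. \<Sum>M\<in>U.
    var1 ^ reduced_size M * var2 ^ max_stat M * z ^ dg_stat M * w ^ iso_stat M)"
  define T where "T = (\<lambda>z w. \<Sum>N\<in>V.
    var1 ^ mat_size N * var2 ^ max_stat N * z ^ min_stat N * w ^ iso_stat N)"
  have fin: "finite U" "finite V" by (simp_all add: U_def V_def)
  \<comment> \<open>The dimension bound ensures that the finite union misses no matrix of reduced
    size \<open>n\<close>.\<close>
  have U: "M \<in> U \<longleftrightarrow> sd M" if "reduced_size M = n" for M
  proof
    assume "sd M"
    hence "M \<in> self_dual_fishburn_mats K (dim_row M - 1)"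
      by (auto simp: sd_def self_dual_fishburn_mats_def fishburn_def)
    with self_dual_dim_le[OF this] that show "M \<in> U" by (auto simp: U_def)
  qed (auto simp: U_def sd_def self_dual_fishburn_mats_def)
  have V: "N \<in> V \<longleftrightarrow> rf N" if "mat_size N = n" for N
  proof
    assume "rf N"
    hence "N \<in> row_fishburn_mats K (dim_row N - 1)"
      by (auto simp: rf_def row_fishburn_mats_def row_fishburn_def)
    with row_dim_le[OF this] that show "N \<in> V" by (auto simp: V_def)
  qed (auto simp: V_def rf_def row_fishburn_mats_def)
  have pos: "dim_row M > 0" if "sd M \<or> rf M" for M
    using that by (auto simp: sd_def rf_def fishburn_def row_fishburn_def)
  have S: "(\<Sum>d<2 * Suc n. \<Sum>M\<in>self_dual_fishburn_mats K d.
    var1 ^ reduced_size M * var2 ^ max_stat M * z ^ dg_stat M * w ^ iso_stat M) = S z w" for z w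
    unfolding S_def U_def
    by (rule sum.UNION_disjoint[symmetric]) (simp, simp, auto simp: self_dual_fishburn_mats_def[of K])
  have T: "(\<Sum>d<Suc n. \<Sum>M\<in>row_fishburn_mats K d.
    var1 ^ mat_size M * var2 ^ max_stat M * z ^ min_stat M * w ^ iso_stat M) = T z w" for z w
    unfolding T_def V_def
    by (rule sum.UNION_disjoint[symmetric]) (simp, simp, auto simp: row_fishburn_mats_def[of K])
  note cong = self_dual_gf_congruence[where x = var1 and y = var2 and K = K and n = n, unfolded S T]
  have eq: "coeff4 (S z w) n m p q = coeff4 (S 0 0) n m p q + coeff4 (T z w) n m p q" for z w m p q
    using coeff4_eq_0_if_power_dvd[OF cong(1), of n z w m p q] by simp
  have eq0: "coeff4 (S 0 0) n m 0 0 = coeff4 (T 1 var2) n m 0 0"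
    using coeff4_eq_0_if_power_dvd[OF cong(2), of n m 0 0] by simp
  have S0: "coeff4 (S 0 0) n m p q =
      int (card {M \<in> {M \<in> U. dg_stat M = 0 \<and> iso_stat M = 0}.
        reduced_size M = n \<and> max_stat M = m \<and> 0 = p \<and> 0 = q})" for m p q
  proof -
    \<comment> \<open>As \<open>0 ^ 0 = 1\<close>, only zero diagonals survive. The powers with
      exponent 0 give the shape of \<open>coeff4_gf\<close> and account for the conditions
      \<open>0 = p\<close> and \<open>0 = q\<close>.\<close>
    have "S 0 0 = (\<Sum>M | M \<in> U \<and> dg_stat M = 0 \<and> iso_stat M = 0.
        var1 ^ reduced_size M * var2 ^ max_stat M * var3 ^ 0 * var4 ^ 0)"
      unfolding S_def sum.inter_filter[OF fin(1)] by (intro sum.cong) auto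
    moreover have "finite {M \<in> U. dg_stat M = 0 \<and> iso_stat M = 0}" using fin by simp
    ultimately show ?thesis by (simp only: coeff4_gf)
  qed
  have zeroU: "{M \<in> {M \<in> U. dg_stat M = 0 \<and> iso_stat M = 0}.
        reduced_size M = n \<and> max_stat M = m \<and> 0 = (0::nat) \<and> 0 = (0::nat)} =
      {M. sd M \<and> reduced_size M = n \<and> last_col_sum M = m \<and> diagonal_zero M}"
    using U pos by (auto simp: last_col_sum_conv diagonal_zero_conv)
  have S1: "coeff4 (S 1 var2) n m 0 0 =
      int (card {M. sd M \<and> reduced_size M = n \<and> last_col_sum M = m})"
  proof -
    have "S 1 var2 = (\<Sum>M\<in>U. var1 ^ reduced_size M * var2 ^ (max_stat M + iso_stat M) *
        var3 ^ 0 * var4 ^ 0)"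
      unfolding S_def by (simp add: power_add mult.assoc)
    moreover have "{M \<in> U. reduced_size M = n \<and> max_stat M + iso_stat M = m \<and> 0 = (0::nat) \<and> 0 = (0::nat)} =
        {M. sd M \<and> reduced_size M = n \<and> last_col_sum M = m}"
      using U pos by (auto simp: last_col_sum_conv)
    ultimately show ?thesis by (simp only: coeff4_gf[OF fin(1)])
  qed
  have T1: "coeff4 (T 1 var2) n m 0 0 =
      int (card {N. rf N \<and> mat_size N = n \<and> last_col_sum N = m})"
  proof -
    have "T 1 var2 = (\<Sum>N\<in>V. var1 ^ mat_size N * var2 ^ (max_stat N + iso_stat N) *
        var3 ^ 0 * var4 ^ 0)"
      unfolding T_def by (simp add: power_add mult.assoc)
    moreover have "{N \<in> V. mat_size N = n \<and> max_stat N + iso_stat N = m \<and> 0 = (0::nat) \<and> 0 = (0::nat)} =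
        {N. rf N \<and> mat_size N = n \<and> last_col_sum N = m}"
      using V pos by (auto simp: last_col_sum_conv)
    ultimately show ?thesis by (simp only: coeff4_gf[OF fin(2)])
  qed
  show ?zero using eq0 S0[of m 0 0] T1 unfolding zeroU by linarith
  have "{M. sd M \<and> reduced_size M = n \<and> last_col_sum M = m} =
      {M. sd M \<and> reduced_size M = n \<and> last_col_sum M = m \<and> diagonal_zero M} \<union>
      {M. sd M \<and> reduced_size M = n \<and> last_col_sum M = m \<and> \<not> diagonal_zero M}" by blast
  moreover have "finite {M. sd M \<and> reduced_size M = n \<and> last_col_sum M = m \<and> diagonal_zero M}"
    "finite {M. sd M \<and> reduced_size M = n \<and> last_col_sum M = m \<and> \<not> diagonal_zero M}"
    using U by (auto intro: finite_subset[OF _ fin(1)])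
  ultimately have "card {M. sd M \<and> reduced_size M = n \<and> last_col_sum M = m} =
      card {M. sd M \<and> reduced_size M = n \<and> last_col_sum M = m \<and> diagonal_zero M} +
      card {M. sd M \<and> reduced_size M = n \<and> last_col_sum M = m \<and> \<not> diagonal_zero M}"
    by (simp only:) (rule card_Un_disjoint, auto)
  \<comment> \<open>By \<open>eq\<close>, the total exceeds the count of zero diagonals by the
    row-Fishburn count.\<close>
  thus ?nonzero using eq[of 1 var2 m 0 0] S0[of m 0 0] T1 S1 unfolding zeroU by linarith
  assume pq: "p + q \<ge> 1"
  \<comment> \<open>\<open>S 0 0\<close> is free of \<open>var3\<close> and \<open>var4\<close>, so
    it drops out once \<open>p\<close> or \<open>q\<close> is positive.\<close>
  have "coeff4 (S 0 0) n m p q = 0" using pq by (cases "p = 0") (auto simp: S0)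
  moreover have "coeff4 (S var3 var4) n m p q = int (card {M. sd M \<and> reduced_size M = n \<and>
      max_stat M = m \<and> dg_stat M = p \<and> iso_stat M = q})"
    unfolding S_def coeff4_gf[OF fin(1)] using U by (intro arg_cong[of _ _ "\<lambda>A. int (card A)"]) auto
  moreover have "coeff4 (T var3 var4) n m p q = int (card {N. rf N \<and> mat_size N = n \<and>
      max_stat N = m \<and> min_stat N = p \<and> iso_stat N = q})"
    unfolding T_def coeff4_gf[OF fin(2)] using V by (intro arg_cong[of _ _ "\<lambda>A. int (card A)"]) auto
  ultimately show
    "card {M. sd M \<and> reduced_size M = n \<and> max_stat M = m \<and> dg_stat M = p \<and> iso_stat M = q} =
      card {N. rf N \<and> mat_size N = n \<and> max_stat N = m \<and> min_stat N = p \<and> iso_stat N = q}"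
    using eq[of var3 var4 m p q] by linarith
qed

section \<open>Primitive matrices and matrices with unrestricted entries\<close>

lemma primitive_mat_conv_bounded: "primitive_mat M \<longleftrightarrow> bounded_entries 1 M"
  by (auto simp: primitive_mat_def bounded_entries_def le_Suc_eq)

text \<open>A cell that is neither a diagonal cell nor an SE-cell is dual to an SE-cell with the
  same entry, so every entry is a summand of the reduced size.\<close>

lemma self_dual_bounded_by_reduced_size:
  assumes "fishburn M" "self_dual M"
  shows "bounded_entries (reduced_size M) M"
  unfolding bounded_entries_def
proof (intro allI impI)
  fix i j assume "i < dim_row M" "j < dim_col M"
  moreover define k where "k = dim_row M"
  ultimately have ij: "i < k" "j < k" and k: "dim_row M = k"
    using assms by (auto simp: fishburn_def)
  have fin: "finite (diagonal_cells M \<union> SE_cells M)"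
    by (rule finite_subset[of _ "{..<k} \<times> {..<k}"]) (auto simp: diagonal_cells_def SE_cells_def k)
  show "M $$ (i, j) \<le> reduced_size M"
  proof (cases "i + j + 1 \<ge> k")
    case True
    hence "(i, j) \<in> diagonal_cells M \<union> SE_cells M"
      using ij by (auto simp: diagonal_cells_def SE_cells_def k)
    thus ?thesis unfolding reduced_size_def using fin by (intro member_le_sum) auto
  next
    case False
    hence "(k - 1 - j, k - 1 - i) \<in> diagonal_cells M \<union> SE_cells M"
      using ij by (auto simp: diagonal_cells_def SE_cells_def k)
    hence "M $$ (k - 1 - j, k - 1 - i) \<le> reduced_size M"
      unfolding reduced_size_def using fin by (intro member_le_sum) auto
    thus ?thesis using self_dualD[OF assms(2), of i j] ij k by simp
  qed
qed

lemma row_bounded_by_size: "bounded_entries (mat_size M) M"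
  unfolding bounded_entries_def
proof (intro allI impI)
  fix i j assume ij: "i < dim_row M" "j < dim_col M"
  have "M $$ (i, j) \<le> (\<Sum>j<dim_col M. M $$ (i, j))"
    using ij by (intro member_le_sum) auto
  also have "\<dots> \<le> mat_size M" unfolding mat_size_def
    using ij by (intro member_le_sum[of i _ "\<lambda>i. \<Sum>j<dim_col M. M $$ (i, j)"]) auto
  finally show "M $$ (i, j) \<le> mat_size M" .
qed

lemma unbounded_counts:
  fixes n m p q :: nat
  shows "card {M. fishburn M \<and> self_dual M \<and> reduced_size M = n \<and> last_col_sum M = m \<and> diagonal_zero M} =
      card {N. row_fishburn N \<and> mat_size N = n \<and> last_col_sum N = m}"
    and "card {M. fishburn M \<and> self_dual M \<and> reduced_size M = n \<and> last_col_sum M = m \<and> \<not> diagonal_zero M} =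
      card {N. row_fishburn N \<and> mat_size N = n \<and> last_col_sum N = m}"
    and "p + q \<ge> 1 \<Longrightarrow>
      card {M. fishburn M \<and> self_dual M \<and> reduced_size M = n \<and> max_stat M = m \<and> dg_stat M = p \<and> iso_stat M = q} =
      card {N. row_fishburn N \<and> mat_size N = n \<and> max_stat N = m \<and> min_stat N = p \<and> iso_stat N = q}"
proof -
  have sd: "(fishburn M \<and> self_dual M \<and> bounded_entries n M) \<and> reduced_size M = n \<and> P \<longleftrightarrow>
      fishburn M \<and> self_dual M \<and> reduced_size M = n \<and> P" for M P
    using self_dual_bounded_by_reduced_size by blast
  have rf: "(row_fishburn N \<and> bounded_entries n N) \<and> mat_size N = n \<and> P \<longleftrightarrow>
      row_fishburn N \<and> mat_size N = n \<and> P" for N P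
    using row_bounded_by_size by blast
  note counts = bounded_counts[where K = n and n = n, unfolded sd rf]
  show "card {M. fishburn M \<and> self_dual M \<and> reduced_size M = n \<and> last_col_sum M = m \<and> diagonal_zero M} =
      card {N. row_fishburn N \<and> mat_size N = n \<and> last_col_sum N = m}" by (rule counts(1))
  show "card {M. fishburn M \<and> self_dual M \<and> reduced_size M = n \<and> last_col_sum M = m \<and> \<not> diagonal_zero M} =
      card {N. row_fishburn N \<and> mat_size N = n \<and> last_col_sum N = m}" by (rule counts(2))
  show "p + q \<ge> 1 \<Longrightarrow>
      card {M. fishburn M \<and> self_dual M \<and> reduced_size M = n \<and> max_stat M = m \<and> dg_stat M = p \<and> iso_stat M = q} =
      card {N. row_fishburn N \<and> mat_size N = n \<and> max_stat N = m \<and> min_stat N = p \<and> iso_stat N = q}"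
    by (rule counts(3))
qed

lemmas primitive_counts = bounded_counts[where K = 1, folded primitive_mat_conv_bounded, unfolded conj_assoc]

theorem theorem15:
  shows "(\<forall>n m :: int. n \<ge> 1 \<and> m \<ge> 1 \<longrightarrow>
      card {M. fishburn M \<and> self_dual M \<and> int (reduced_size M) = n \<and>
               int (last_col_sum M) = m \<and> diagonal_zero M} =
      card {M. fishburn M \<and> self_dual M \<and> int (reduced_size M) = n \<and>
               int (last_col_sum M) = m \<and> \<not> diagonal_zero M} \<and>
      card {M. fishburn M \<and> self_dual M \<and> int (reduced_size M) = n \<and>
               int (last_col_sum M) = m \<and> \<not> diagonal_zero M} =
      card {N. row_fishburn N \<and> int (mat_size N) = n \<and> int (last_col_sum N) = m}) \<and>
    (\<forall>n m p q :: int. p + q \<ge> 1 \<longrightarrow>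
      card {M. fishburn M \<and> self_dual M \<and> int (reduced_size M) = n \<and>
               int (max_stat M) = m \<and> int (dg_stat M) = p \<and> int (iso_stat M) = q} =
      card {N. row_fishburn N \<and> int (mat_size N) = n \<and>
               int (max_stat N) = m \<and> int (min_stat N) = p \<and> int (iso_stat N) = q}) \<and>
    (\<forall>n m :: int. n \<ge> 1 \<and> m \<ge> 1 \<longrightarrow>
      card {M. fishburn M \<and> self_dual M \<and> primitive_mat M \<and> int (reduced_size M) = n \<and>
               int (last_col_sum M) = m \<and> diagonal_zero M} =
      card {M. fishburn M \<and> self_dual M \<and> primitive_mat M \<and> int (reduced_size M) = n \<and>
               int (last_col_sum M) = m \<and> \<not> diagonal_zero M} \<and>
      card {M. fishburn M \<and> self_dual M \<and> primitive_mat M \<and> int (reduced_size M) = n \<and>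
               int (last_col_sum M) = m \<and> \<not> diagonal_zero M} =
      card {N. row_fishburn N \<and> primitive_mat N \<and> int (mat_size N) = n \<and> int (last_col_sum N) = m}) \<and>
    (\<forall>n m p q :: int. p + q \<ge> 1 \<longrightarrow>
      card {M. fishburn M \<and> self_dual M \<and> primitive_mat M \<and> int (reduced_size M) = n \<and>
               int (max_stat M) = m \<and> int (dg_stat M) = p \<and> int (iso_stat M) = q} =
      card {N. row_fishburn N \<and> primitive_mat N \<and> int (mat_size N) = n \<and>
               int (max_stat N) = m \<and> int (min_stat N) = p \<and> int (iso_stat N) = q})"
proof (intro conjI allI impI)
  fix n m :: int
  assume "n \<ge> 1 \<and> m \<ge> 1"
  then obtain n' m' where [simp]: "n = int n'" "m = int m'" by (metis nonneg_int_cases order_trans zero_le_one)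
  show "card {M. fishburn M \<and> self_dual M \<and> int (reduced_size M) = n \<and>
               int (last_col_sum M) = m \<and> diagonal_zero M} =
      card {M. fishburn M \<and> self_dual M \<and> int (reduced_size M) = n \<and>
               int (last_col_sum M) = m \<and> \<not> diagonal_zero M}"
    by (simp add: unbounded_counts)
  show "card {M. fishburn M \<and> self_dual M \<and> int (reduced_size M) = n \<and>
               int (last_col_sum M) = m \<and> \<not> diagonal_zero M} =
      card {N. row_fishburn N \<and> int (mat_size N) = n \<and> int (last_col_sum N) = m}"
    by (simp add: unbounded_counts)
  show "card {M. fishburn M \<and> self_dual M \<and> primitive_mat M \<and> int (reduced_size M) = n \<and>
               int (last_col_sum M) = m \<and> diagonal_zero M} =
      card {M. fishburn M \<and> self_dual M \<and> primitive_mat M \<and> int (reduced_size M) = n \<and>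
               int (last_col_sum M) = m \<and> \<not> diagonal_zero M}"
    by (simp add: primitive_counts)
  show "card {M. fishburn M \<and> self_dual M \<and> primitive_mat M \<and> int (reduced_size M) = n \<and>
               int (last_col_sum M) = m \<and> \<not> diagonal_zero M} =
      card {N. row_fishburn N \<and> primitive_mat N \<and> int (mat_size N) = n \<and> int (last_col_sum N) = m}"
    by (simp add: primitive_counts)
next
  fix n m p q :: int
  assume pq: "p + q \<ge> 1"
  have "card {M. fishburn M \<and> self_dual M \<and> int (reduced_size M) = n \<and>
               int (max_stat M) = m \<and> int (dg_stat M) = p \<and> int (iso_stat M) = q} =
      card {N. row_fishburn N \<and> int (mat_size N) = n \<and>
               int (max_stat N) = m \<and> int (min_stat N) = p \<and> int (iso_stat N) = q} \<and>
      card {M. fishburn M \<and> self_dual M \<and> primitive_mat M \<and> int (reduced_size M) = n \<and>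
               int (max_stat M) = m \<and> int (dg_stat M) = p \<and> int (iso_stat M) = q} =
      card {N. row_fishburn N \<and> primitive_mat N \<and> int (mat_size N) = n \<and>
               int (max_stat N) = m \<and> int (min_stat N) = p \<and> int (iso_stat N) = q}"
  proof (cases "0 \<le> n \<and> 0 \<le> m \<and> 0 \<le> p \<and> 0 \<le> q")
    case True
    then obtain n' m' p' q' where [simp]: "n = int n'" "m = int m'" "p = int p'" "q = int q'"
      by (metis nonneg_int_cases)
    have "p' + q' \<ge> 1" using pq by simp
    thus ?thesis by (simp add: unbounded_counts primitive_counts)
  next
    case False
    hence "n < 0 \<or> m < 0 \<or> p < 0 \<or> q < 0" by auto
    \<comment> \<open>No statistic is negative, so for a negative parameter both sets are
      empty.\<close>
    moreover have "(int k = a) = False" if "a < 0" for k a using that by auto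
    ultimately show ?thesis by (elim disjE) simp_all
  qed
  thus "card {M. fishburn M \<and> self_dual M \<and> int (reduced_size M) = n \<and>
               int (max_stat M) = m \<and> int (dg_stat M) = p \<and> int (iso_stat M) = q} =
      card {N. row_fishburn N \<and> int (mat_size N) = n \<and>
               int (max_stat N) = m \<and> int (min_stat N) = p \<and> int (iso_stat N) = q}"
    and "card {M. fishburn M \<and> self_dual M \<and> primitive_mat M \<and> int (reduced_size M) = n \<and>
               int (max_stat M) = m \<and> int (dg_stat M) = p \<and> int (iso_stat M) = q} =
      card {N. row_fishburn N \<and> primitive_mat N \<and> int (mat_size N) = n \<and>
               int (max_stat N) = m \<and> int (min_stat N) = p \<and> int (iso_stat N) = q}"
    by simp_all
qed

end
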